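(* Let $(b^*,u^* )$ be a uniformly $\tau$-overtaking optimal process for the problem of minimizing $l(b)+\int_0^\infty f_0(x,u,t)\,dt$ subject to $\dot x=f(x,u,t)$, $u(t)\in U(t)$, $x(0)=b\in\mathcal C$, and let $f$ and $f_0$ be linear in $x$. Let there exist a $\tau$-limiting solution $(\psi^*,\lambda^* )$ of the PMP system associated with $(x^*,u^* )$. Then, for some subsequence $\tau'\subset\tau$, up to multiplication of $(\psi^*,\lambda^* )$ by a positive factor, one of the following two relations also holds: either the sequence $I(b^*;\tau'_n)$ has a finite limit and $$\lambda^*=1,\qquad \psi^*(0)=-\lim_{n\to\infty}I(b^*;\tau'_n)\in\partial_L l(b^* )+N_L^{\mathcal C}(b^* );$$ or the sequence $\|I(b^*;\tau'_n)\|$ is unbounded, the limit below exists, and $$\lambda^*=0,\qquad \psi^*(0)=-\lim_{n\to\infty}\frac{I(b^*;\tau'_n)}{\|I(b^*;\tau'_n)\|}\in N_L^{\mathcal C}(b^* ).$$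
   Context: Setting. $\mathbb T=[0,\infty)$, $\mathbb X=\mathbb R^m$, $\mathbb U$ is a finite-dimensional Euclidean space; $f:\mathbb X\times\mathbb U\times\mathbb T\to\mathbb X$, $f_0:\mathbb X\times\mathbb U\times\mathbb T\to\mathbb R$, $l:\mathbb X\to\mathbb R$. $U$ maps each $t\in\mathbb T$ to a closed subset $U(t)$ of $\mathbb U$ and has Borel graph. The set $\mathfrak U$ of admissible controls consists of the measurable functions $u:\mathbb T\to\mathbb U$, bounded on every compact time interval, with $u(t)\in U(t)$ for a.a. $t$. Assumptions: $\mathcal C\subset\mathbb X$ is closed; $l$ is locally Lipschitz; $f$ is Borel measurable in $(t,u)$ and continuously differentiable in $x$; for each $u\in\mathfrak U$ the map $(t,x)\mapsto f(x,u(t),t)$ satisfies the sublinear growth condition ($\|f(x,u(t),t)\|\le L_u(t)(1+\|x\|)$ with $L_u$ locally integrable); $f_0$ is measurable in $(t,u)$, continuously differentiable in $x$ and lower semicontinuous in $u$; $\partial f/\partial x$, $\partial f_0/\partial x$ are measurable in $(t,u)$ and locally Lipschitz in $x$. It is also understood that along admissible controls the right-hand sides are Carathéodory and that $f,f_0,\partial f/\partial x,\partial f_0/\partial x$ are, on bounded sets of $(x,u)$, bounded by locally integrable functions of $t$ and Lipschitz in $x$ with locally integrable constants. $\tau=(\tau_n)$ is an unboundedly increasing sequence of positive times. For $b\in\mathbb X$, $u\in\mathfrak U$, $x(b,u;\cdot)$ is the unique solution on $\mathbb T$ of $\dot x=f(x,u(t),t)$, $x(0)=b$; $J(b,u;T)=\int_0^T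 f_0(x(b,u;t),u(t),t)\,dt$; $x^*=x(b^*,u^*;\cdot)$. Optimality. $(b^*,u^* )\in\mathcal C\times\mathfrak U$ is uniformly $\tau$-overtaking optimal if $\liminf_{n\to\infty}\big(l(b^* )+J(b^*,u^*;\tau_n)-\inf_{(b,u)\in\mathcal C\times\mathfrak U}(l(b)+J(b,u;\tau_n))\big)\ge0$. PMP system. $H(x,u,\psi,\lambda,t)=\psi f(x,u,t)-\lambda f_0(x,u,t)$, $\lambda\ge0$ ($\psi f$ is the scalar product; $\psi$ is a row vector). A pair $(\psi,\lambda)$, $\lambda\ge 0$ constant, is a solution of the PMP system associated with $(x^*,u^* )$ if $-\dot\psi(t)=\frac{\partial H}{\partial x}(x^*(t),u^*(t),\psi(t),\lambda,t)$ and $\sup_{v\in U(t)}H(x^*(t),v,\psi(t),\lambda,t)=H(x^*(t),u^*(t),\psi(t),\lambda,t)$ for a.e. $t\ge0$. It is nontrivial if $(\psi,\lambda)\neq(0,0)$. A nontrivial solution $(\psi^*,\lambda^* )$ is $\tau$-limiting if there are a subsequence $\tau'\subset\tau$ and triples $(x_n,\psi_n,\lambda_n)$ with constant $\lambda_n\ge0$, solving $\dot x=f(x,u^*(t),t)$, $-\dot\psi=\frac{\partial H}{\partial x}(x,u^*(t),\psi,\lambda_n,t)$, with $\psi_n(\tau'_n)=0$, which converge pointwise on $\mathbb T$ to $(x^*,\psi^*,\lambda^* )$. Matrix $A$ and vector $I$. For $\xi\in\mathbb X$, $A(\xi;\cdot)$ is the $m\times m$ matrix solution of $\frac{d}{dt}A(\xi;t)=\frac{\partial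 f}{\partial x}(x(\xi,u^*;t),u^*(t),t)A(\xi;t)$, $A(\xi;0)=$ identity, and $I(\xi;T)=\int_0^T\frac{\partial f_0}{\partial x}(x(\xi,u^*;t),u^*(t),t)\,A(\xi;t)\,dt$. Nonsmooth notions. $\zeta$ is a proximal subgradient of $g$ at $b$ ($\zeta\in\partial_Pg(b)$) if for some $\sigma\ge0$ and neighborhood $\Omega$ of $b$, $g(\xi)\ge g(b)+\zeta(\xi-b)-\sigma\|\xi-b\|^2$ for all $\xi\in\Omega$. The limiting subdifferential $\partial_Lg(b)$ is the set of limits of $\zeta_n\in\partial_Pg(b_n)$ with $b_n\to b$. $N_P^{\mathcal C}(b)$ is the set of $\zeta$ such that for some $\sigma\ge0$, $\zeta(\xi-b)\le\sigma\|\xi-b\|^2$ for all $\xi\in\mathcal C$; $N_L^{\mathcal C}(b)$ is the set of limits of $\zeta_n\in N_P^{\mathcal C}(b_n)$ with $b_n\in\mathcal C$, $b_n\to b$.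
   Formalization: Uniform τ-overtaking optimality is taken as liminf(inf(l(b)+J(b,u;τ_n)) − l(b* ) − J(b*,u*;τ_n)) ≥ 0; the printed condition has the two terms exchanged, holds for every process, and makes the claim false (f=f_0=0, l(b)=b, C=ℝ). *)

theory Defs
  imports "HOL-Analysis.Analysis"
begin

section \<open>Derivatives in the state variable\<close>

text \<open>The row vector of partial derivatives of a scalar function. Row vectors are elements of the
  same type as points; the product of two of them is the scalar product.\<close>

definition gradient :: "('a::real_inner \<Rightarrow> real) \<Rightarrow> 'a \<Rightarrow> 'a" where
  "gradient g x = (THE D. GDERIV g x :> D)"

definition vector_field_dx ::
    "(real^'m \<Rightarrow> 'u \<Rightarrow> real \<Rightarrow> real^'m) \<Rightarrow> real^'m \<Rightarrow> 'u \<Rightarrow> real \<Rightarrow> real^'m^'m" where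
  "vector_field_dx f x u t = jacobian (\<lambda>y. f y u t) (at x)"

definition integrand_dx ::
    "(real^'m \<Rightarrow> 'u \<Rightarrow> real \<Rightarrow> real) \<Rightarrow> real^'m \<Rightarrow> 'u \<Rightarrow> real \<Rightarrow> real^'m" where
  "integrand_dx f0 x u t = gradient (\<lambda>y. f0 y u t) x"

text \<open>``Linear in the state'' in the sense of control theory: an inhomogeneous term depending on
  \<open>(u, t)\<close> is permitted. Homogeneous linearity is the special case \<open>g 0 u t = 0\<close>.\<close>

definition linear_in_state ::
    "('a::real_vector \<Rightarrow> 'u \<Rightarrow> real \<Rightarrow> 'b::real_vector) \<Rightarrow> bool" where
  "linear_in_state g \<longleftrightarrow> (\<forall>u. \<forall>t\<ge>0. linear (\<lambda>x. g x u t - g 0 u t))"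


section \<open>Differential equations in the sense of Caratheodory\<close>

text \<open>All functions of time are considered on \<open>{0..}\<close> only; their values at negative times are
  irrelevant throughout.\<close>

definition locally_integrable :: "(real \<Rightarrow> real) \<Rightarrow> bool" where
  "locally_integrable L \<longleftrightarrow> (\<forall>T\<ge>0. set_integrable lebesgue {0..T} L)"

definition absolutely_continuous_on :: "real set \<Rightarrow> (real \<Rightarrow> 'a::real_normed_vector) \<Rightarrow> bool" where
  "absolutely_continuous_on S g \<longleftrightarrow>
     (\<forall>\<epsilon>>0. \<exists>\<delta>>0. \<forall>D. D division_of \<Union>D \<and> \<Union>D \<subseteq> S \<and> (\<Sum>k\<in>D. Sup k - Inf k) < \<delta> \<longrightarrow>
        (\<Sum>k\<in>D. norm (g (Sup k) - g (Inf k))) < \<epsilon>)"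

definition ode_solution :: "(real \<Rightarrow> 'a \<Rightarrow> 'a) \<Rightarrow> (real \<Rightarrow> 'a::real_normed_vector) \<Rightarrow> bool" where
  "ode_solution rhs x \<longleftrightarrow>
     (\<forall>T\<ge>0. absolutely_continuous_on {0..T} x) \<and>
     (AE t in lebesgue_on {0..}. (x has_vector_derivative rhs t (x t)) (at t within {0..}))"

definition caratheodory ::
    "(real \<Rightarrow> 'a::topological_space \<Rightarrow> 'b::topological_space) \<Rightarrow> bool" where
  "caratheodory g \<longleftrightarrow>
     (\<forall>x. (\<lambda>t. g t x) \<in> borel_measurable (lebesgue_on {0..})) \<and>
     (AE t in lebesgue_on {0..}. continuous_on UNIV (g t))"


section \<open>Standing assumptions\<close>

definition admissible_controls :: "(real \<Rightarrow> 'u::euclidean_space set) \<Rightarrow> (real \<Rightarrow> 'u) set" where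
  "admissible_controls U = {u. u \<in> borel_measurable (lebesgue_on {0..}) \<and>
     (\<forall>T\<ge>0. bounded (u ` {0..T})) \<and> (AE t in lebesgue_on {0..}. u t \<in> U t)}"

definition locally_lipschitz :: "('a::metric_space \<Rightarrow> 'b::metric_space) \<Rightarrow> bool" where
  "locally_lipschitz g \<longleftrightarrow> (\<forall>x. \<exists>r>0. \<exists>L. L-lipschitz_on (cball x r) g)"

definition lower_semicontinuous :: "('a::topological_space \<Rightarrow> real) \<Rightarrow> bool" where
  "lower_semicontinuous g \<longleftrightarrow> (\<forall>x. \<forall>a<g x. \<forall>\<^sub>F y in nhds x. a < g y)"

definition Borel_measurable_in_tu ::
    "('a \<Rightarrow> 'u::euclidean_space \<Rightarrow> real \<Rightarrow> 'b::topological_space) \<Rightarrow> bool" where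
  "Borel_measurable_in_tu g \<longleftrightarrow>
     (\<forall>x. (\<lambda>(t, u). g x u t) \<in> borel_measurable (restrict_space borel ({0..} \<times> UNIV)))"

text \<open>Measurability with respect to the product of the Lebesgue \<open>\<sigma>\<close>-algebra in \<open>t\<close> and the Borel
  \<open>\<sigma>\<close>-algebra in \<open>u\<close>, as usual in control theory. It is implied by Borel measurability.\<close>

definition LB_measurable_in_tu ::
    "('a \<Rightarrow> 'u::euclidean_space \<Rightarrow> real \<Rightarrow> 'b::topological_space) \<Rightarrow> bool" where
  "LB_measurable_in_tu g \<longleftrightarrow>
     (\<forall>x. (\<lambda>(t, u). g x u t) \<in> borel_measurable (lebesgue_on {0..} \<Otimes>\<^sub>M borel))"

definition locally_bounded_lipschitz ::
    "('a::real_normed_vector \<Rightarrow> 'u::real_normed_vector \<Rightarrow> real \<Rightarrow> 'b::real_normed_vector) \<Rightarrow> bool" where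
  "locally_bounded_lipschitz g \<longleftrightarrow>
     (\<forall>r. \<exists>M L. locally_integrable M \<and> locally_integrable L \<and>
        (AE t in lebesgue_on {0..}. \<forall>u x y. norm u \<le> r \<and> norm x \<le> r \<and> norm y \<le> r \<longrightarrow>
           norm (g x u t) \<le> M t \<and> norm (g x u t - g y u t) \<le> L t * norm (x - y)))"

locale control_problem =
  fixes f :: "real^'m \<Rightarrow> 'u::euclidean_space \<Rightarrow> real \<Rightarrow> real^'m"
    and f0 :: "real^'m \<Rightarrow> 'u \<Rightarrow> real \<Rightarrow> real"
    and l :: "real^'m \<Rightarrow> real"
    and U :: "real \<Rightarrow> 'u set"
    and C :: "(real^'m) set"
  assumes U_closed: "\<And>t. t \<ge> 0 \<Longrightarrow> closed (U t)"
    and U_graph: "{(t, v). t \<ge> 0 \<and> v \<in> U t} \<in> sets borel"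
    and C_closed: "closed C"
    and l_lipschitz: "locally_lipschitz l"
    and f_measurable: "Borel_measurable_in_tu f"
    and f_differentiable: "\<And>x u t. t \<ge> 0 \<Longrightarrow> (\<lambda>y. f y u t) differentiable (at x)"
    and f_C1: "\<And>u t. t \<ge> 0 \<Longrightarrow> continuous_on UNIV (\<lambda>x. vector_field_dx f x u t)"
    and f_growth: "\<And>u. u \<in> admissible_controls U \<Longrightarrow>
          \<exists>L. locally_integrable L \<and>
            (AE t in lebesgue_on {0..}. \<forall>x. norm (f x (u t) t) \<le> L t * (1 + norm x))"
    and f0_measurable: "LB_measurable_in_tu f0"
    and f0_differentiable: "\<And>x u t. t \<ge> 0 \<Longrightarrow> (\<lambda>y. f0 y u t) differentiable (at x)"
    and f0_C1: "\<And>u t. t \<ge> 0 \<Longrightarrow> continuous_on UNIV (\<lambda>x. integrand_dx f0 x u t)"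
    and f0_lsc: "\<And>x t. t \<ge> 0 \<Longrightarrow> lower_semicontinuous (\<lambda>u. f0 x u t)"
    and f_dx_measurable: "LB_measurable_in_tu (vector_field_dx f)"
    and f0_dx_measurable: "LB_measurable_in_tu (integrand_dx f0)"
    and f_dx_lipschitz: "\<And>u t. t \<ge> 0 \<Longrightarrow> locally_lipschitz (\<lambda>x. vector_field_dx f x u t)"
    and f0_dx_lipschitz: "\<And>u t. t \<ge> 0 \<Longrightarrow> locally_lipschitz (\<lambda>x. integrand_dx f0 x u t)"
    and f_caratheodory: "\<And>u. u \<in> admissible_controls U \<Longrightarrow> caratheodory (\<lambda>t x. f x (u t) t)"
    and f0_caratheodory: "\<And>u. u \<in> admissible_controls U \<Longrightarrow> caratheodory (\<lambda>t x. f0 x (u t) t)"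
    and f_dx_caratheodory: "\<And>u. u \<in> admissible_controls U \<Longrightarrow>
          caratheodory (\<lambda>t x. vector_field_dx f x (u t) t)"
    and f0_dx_caratheodory: "\<And>u. u \<in> admissible_controls U \<Longrightarrow>
          caratheodory (\<lambda>t x. integrand_dx f0 x (u t) t)"
    and f_bounds: "locally_bounded_lipschitz f"
    and f0_bounds: "locally_bounded_lipschitz f0"
    and f_dx_bounds: "locally_bounded_lipschitz (vector_field_dx f)"
    and f0_dx_bounds: "locally_bounded_lipschitz (integrand_dx f0)"


section \<open>Trajectories, cost and optimality\<close>

text \<open>On \<open>{0..}\<close> the solution of the Cauchy problem exists and is unique under the standing
  assumptions, so the choice operator only fixes irrelevant values at negative times.\<close>

definition trajectory ::
    "('a \<Rightarrow> 'u \<Rightarrow> real \<Rightarrow> 'a) \<Rightarrow> 'a \<Rightarrow> (real \<Rightarrow> 'u) \<Rightarrow> real \<Rightarrow> 'a::real_normed_vector" where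
  "trajectory f b u = (SOME x. ode_solution (\<lambda>t y. f y (u t) t) x \<and> x 0 = b)"

definition cost ::
    "('a \<Rightarrow> 'u \<Rightarrow> real \<Rightarrow> 'a) \<Rightarrow> ('a \<Rightarrow> 'u \<Rightarrow> real \<Rightarrow> real) \<Rightarrow>
     'a::real_normed_vector \<Rightarrow> (real \<Rightarrow> 'u) \<Rightarrow> real \<Rightarrow> real" where
  "cost f f0 b u T = (LINT t:{0..T}|lebesgue. f0 (trajectory f b u t) (u t) t)"

text \<open>The excess of the cost over the infimum is nonnegative by definition; optimality requires it
  to vanish asymptotically, i.e. the lower limit of (infimum minus cost) to be nonnegative. The
  infimum is taken in the extended reals, so that it may be \<open>-\<infinity>\<close>, in which case the
  difference below is \<open>-\<infinity>\<close> as well.\<close>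

definition uniformly_overtaking_optimal ::
    "('a \<Rightarrow> 'u \<Rightarrow> real \<Rightarrow> 'a) \<Rightarrow> ('a \<Rightarrow> 'u \<Rightarrow> real \<Rightarrow> real) \<Rightarrow> ('a \<Rightarrow> real) \<Rightarrow>
     (real \<Rightarrow> 'u::euclidean_space set) \<Rightarrow> 'a set \<Rightarrow> (nat \<Rightarrow> real) \<Rightarrow>
     'a::real_normed_vector \<Rightarrow> (real \<Rightarrow> 'u) \<Rightarrow> bool" where
  "uniformly_overtaking_optimal f f0 l U C \<tau> b' u' \<longleftrightarrow>
     b' \<in> C \<and> u' \<in> admissible_controls U \<and>
     liminf (\<lambda>n. (INF (b, u) \<in> C \<times> admissible_controls U. ereal (l b + cost f f0 b u (\<tau> n)))
                 - ereal (l b' + cost f f0 b' u' (\<tau> n))) \<ge> 0"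


section \<open>The system of the Pontryagin maximum principle\<close>

definition hamiltonian ::
    "('a \<Rightarrow> 'u \<Rightarrow> real \<Rightarrow> 'a) \<Rightarrow> ('a \<Rightarrow> 'u \<Rightarrow> real \<Rightarrow> real) \<Rightarrow>
     'a::real_inner \<Rightarrow> 'u \<Rightarrow> 'a \<Rightarrow> real \<Rightarrow> real \<Rightarrow> real" where
  "hamiltonian f f0 x u \<psi> lam t = inner \<psi> (f x u t) - lam * f0 x u t"

definition adjoint_solution ::
    "('a \<Rightarrow> 'u \<Rightarrow> real \<Rightarrow> 'a) \<Rightarrow> ('a \<Rightarrow> 'u \<Rightarrow> real \<Rightarrow> real) \<Rightarrow>
     (real \<Rightarrow> 'a) \<Rightarrow> (real \<Rightarrow> 'u) \<Rightarrow> (real \<Rightarrow> 'a::real_inner) \<Rightarrow> real \<Rightarrow> bool" where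
  "adjoint_solution f f0 x u \<psi> lam \<longleftrightarrow>
     ode_solution (\<lambda>t p. - gradient (\<lambda>y. hamiltonian f f0 y (u t) p lam t) (x t)) \<psi>"

definition pmp_solution ::
    "('a \<Rightarrow> 'u \<Rightarrow> real \<Rightarrow> 'a) \<Rightarrow> ('a \<Rightarrow> 'u \<Rightarrow> real \<Rightarrow> real) \<Rightarrow> (real \<Rightarrow> 'u set) \<Rightarrow>
     (real \<Rightarrow> 'a) \<Rightarrow> (real \<Rightarrow> 'u) \<Rightarrow> (real \<Rightarrow> 'a::real_inner) \<Rightarrow> real \<Rightarrow> bool" where
  "pmp_solution f f0 U x u \<psi> lam \<longleftrightarrow>
     lam \<ge> 0 \<and> adjoint_solution f f0 x u \<psi> lam \<and>
     (AE t in lebesgue_on {0..}.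
        (SUP v\<in>U t. ereal (hamiltonian f f0 (x t) v (\<psi> t) lam t)) =
          ereal (hamiltonian f f0 (x t) (u t) (\<psi> t) lam t))"

definition nontrivial_pair :: "(real \<Rightarrow> 'a::zero) \<Rightarrow> real \<Rightarrow> bool" where
  "nontrivial_pair \<psi> lam \<longleftrightarrow> (\<exists>t\<ge>0. \<psi> t \<noteq> 0) \<or> lam \<noteq> 0"

definition limiting_pmp_solution ::
    "('a \<Rightarrow> 'u \<Rightarrow> real \<Rightarrow> 'a) \<Rightarrow> ('a \<Rightarrow> 'u \<Rightarrow> real \<Rightarrow> real) \<Rightarrow> (real \<Rightarrow> 'u set) \<Rightarrow>
     (nat \<Rightarrow> real) \<Rightarrow> (real \<Rightarrow> 'a) \<Rightarrow> (real \<Rightarrow> 'u) \<Rightarrow> (real \<Rightarrow> 'a::real_inner) \<Rightarrow> real \<Rightarrow> bool" where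
  "limiting_pmp_solution f f0 U \<tau> x u \<psi> lam \<longleftrightarrow>
     pmp_solution f f0 U x u \<psi> lam \<and> nontrivial_pair \<psi> lam \<and>
     (\<exists>r x\<^sub>n \<psi>\<^sub>n lam\<^sub>n. strict_mono (r :: nat \<Rightarrow> nat) \<and>
        (\<forall>n. lam\<^sub>n n \<ge> 0 \<and>
             ode_solution (\<lambda>t y. f y (u t) t) (x\<^sub>n n) \<and>
             adjoint_solution f f0 (x\<^sub>n n) u (\<psi>\<^sub>n n) (lam\<^sub>n n) \<and>
             \<psi>\<^sub>n n (\<tau> (r n)) = 0) \<and>
        (\<forall>t\<ge>0. (\<lambda>n. x\<^sub>n n t) \<longlonglongrightarrow> x t) \<and>
        (\<forall>t\<ge>0. (\<lambda>n. \<psi>\<^sub>n n t) \<longlonglongrightarrow> \<psi> t) \<and>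
        lam\<^sub>n \<longlonglongrightarrow> lam)"


section \<open>The matrix \<open>A\<close> and the vector \<open>I\<close>\<close>

text \<open>As for trajectories, the solution is unique on \<open>{0..}\<close>.\<close>

definition variation_matrix ::
    "(real^'m \<Rightarrow> 'u \<Rightarrow> real \<Rightarrow> real^'m) \<Rightarrow> (real \<Rightarrow> 'u) \<Rightarrow> real^'m \<Rightarrow> real \<Rightarrow> real^'m^'m" where
  "variation_matrix f u \<xi> =
     (SOME A. ode_solution (\<lambda>t B. vector_field_dx f (trajectory f \<xi> u t) (u t) t ** B) A \<and>
              A 0 = mat 1)"

definition variation_integral ::
    "(real^'m \<Rightarrow> 'u \<Rightarrow> real \<Rightarrow> real^'m) \<Rightarrow> (real^'m \<Rightarrow> 'u \<Rightarrow> real \<Rightarrow> real) \<Rightarrow>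
     (real \<Rightarrow> 'u) \<Rightarrow> real^'m \<Rightarrow> real \<Rightarrow> real^'m" where
  "variation_integral f f0 u \<xi> T =
     (LINT t:{0..T}|lebesgue.
        integrand_dx f0 (trajectory f \<xi> u t) (u t) t v* variation_matrix f u \<xi> t)"


section \<open>Subdifferentials and normal cones\<close>

definition proximal_subdifferential :: "('a::real_inner \<Rightarrow> real) \<Rightarrow> 'a \<Rightarrow> 'a set" where
  "proximal_subdifferential g b =
     {\<zeta>. \<exists>\<sigma>\<ge>0. \<forall>\<^sub>F \<xi> in nhds b. g \<xi> \<ge> g b + inner \<zeta> (\<xi> - b) - \<sigma> * (norm (\<xi> - b))\<^sup>2}"

definition limiting_subdifferential :: "('a::real_inner \<Rightarrow> real) \<Rightarrow> 'a \<Rightarrow> 'a set" where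
  "limiting_subdifferential g b =
     {\<zeta>. \<exists>b\<^sub>n \<zeta>\<^sub>n. (\<forall>n::nat. \<zeta>\<^sub>n n \<in> proximal_subdifferential g (b\<^sub>n n)) \<and>
          b\<^sub>n \<longlonglongrightarrow> b \<and> \<zeta>\<^sub>n \<longlonglongrightarrow> \<zeta>}"

definition proximal_normal_cone :: "'a::real_inner set \<Rightarrow> 'a \<Rightarrow> 'a set" where
  "proximal_normal_cone C b =
     {\<zeta>. \<exists>\<sigma>\<ge>0. \<forall>\<xi>\<in>C. inner \<zeta> (\<xi> - b) \<le> \<sigma> * (norm (\<xi> - b))\<^sup>2}"

definition limiting_normal_cone :: "'a::real_inner set \<Rightarrow> 'a \<Rightarrow> 'a set" where
  "limiting_normal_cone C b =
     {\<zeta>. \<exists>b\<^sub>n \<zeta>\<^sub>n. (\<forall>n::nat. b\<^sub>n n \<in> C \<and> \<zeta>\<^sub>n n \<in> proximal_normal_cone C (b\<^sub>n n)) \<and>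
          b\<^sub>n \<longlonglongrightarrow> b \<and> \<zeta>\<^sub>n \<longlonglongrightarrow> \<zeta>}"

end

theory Submission
  imports Defs
begin

text \<open>
  Linearity in the state makes everything that depends on the initial point explicit. Fix the
  control \<open>u\<close>. Then \<open>\<partial>f/\<partial>x\<close> and \<open>\<partial>f\<^sub>0/\<partial>x\<close> along a trajectory do not depend on that trajectory, so
  neither do \<open>A\<close>, \<open>I\<close> and the adjoint equation, and trajectories differ by \<open>A\<close> applied to the
  difference of the initial points. Two identities follow.

  \<^item> Along the adjoint equation \<open>d/dt (\<psi> A) = \<lambda> (\<partial>f\<^sub>0/\<partial>x) A\<close>, hence \<open>\<psi>(T) A(T) = \<psi>(0) + \<lambda> I(T)\<close>
    (\<open>adjoint_formula\<close>). The boundary condition \<open>\<psi>\<^sub>n(\<tau>'\<^sub>n) = 0\<close> of the approximating triples therefore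
    says exactly \<open>\<psi>\<^sub>n(0) = - \<lambda>\<^sub>n I(\<tau>'\<^sub>n)\<close>.
  \<^item> The cost is affine in the initial point with slope \<open>I(T)\<close> (\<open>cost_affine\<close>), so overtaking optimality,
    tested with the optimal control only, says that \<open>b*\<close> minimizes \<open>l(b) + I(\<tau>\<^sub>n) b\<close> over \<open>C\<close> up to an error
    that tends to zero.

  If \<open>\<lambda>* > 0\<close>, the first identity shows that \<open>I(\<tau>'\<^sub>n)\<close> converges to some \<open>v = - \<psi>*(0) / \<lambda>*\<close>, and the
  errors disappear in the limit of the second: \<open>b*\<close> is an exact minimizer of \<open>l(b) + v b\<close> over \<open>C\<close>.
  The sum rule for a Lipschitz function and a closed set, in the form of the stationarity condition
  \<open>minimum_stationary\<close>, gives \<open>- v\<close> in the sum of the subdifferential and the normal cone. If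
  \<open>\<lambda>* = 0\<close>, then \<open>\<psi>*(0) \<noteq> 0\<close> because the pair is nontrivial and the adjoint equation is linear
  homogeneous; hence \<open>\<parallel>I(\<tau>'\<^sub>n)\<parallel>\<close> tends to infinity while its direction converges to
  \<open>v = - \<psi>*(0) / \<parallel>\<psi>*(0)\<parallel>\<close>. Dividing the almost-minimality by \<open>\<parallel>I(\<tau>'\<^sub>n)\<parallel>\<close> removes \<open>l\<close> and leaves
  \<open>v (b - b*) \<ge> 0\<close> on \<open>C\<close>, so that \<open>- v\<close> is even a proximal normal.

  Trajectories and \<open>A\<close> are chosen solutions of Caratheodory equations, so existence and
  uniqueness have to be established first. Both rest on the fundamental theorem of calculus for
  absolutely continuous functions and on the almost everywhere differentiability of indefinite
  integrals. Since one trajectory along the control comes with the limiting solution, existence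
  reduces to homogeneous linear equations, where it is a contraction argument
  (\<open>linear_ode_exists\<close>), and uniqueness follows from the existence of a solution of the inverse
  matrix equation.
\<close>


section \<open>Absolutely continuous functions\<close>

lemma division_of_UnionE:
  fixes D :: "real set set"
  assumes "D division_of \<Union>D" "\<Union>D \<subseteq> S" "k \<in> D"
  obtains u v where "k = {u..v}" "u \<le> v" "u \<in> S" "v \<in> S" "Sup k = v" "Inf k = u" "{u..v} \<subseteq> S"
proof -
  obtain u v where k: "k = cbox u v" and "k \<noteq> {}"
    using division_ofD(3,4)[OF assms(1,3)] by blast
  then have "u \<le> v" by simp
  then show thesis
    using that[of u v] k assms(2) Union_upper[OF assms(3)] by (auto simp: subset_iff)
qed

text \<open>All closure properties below are instances of this comparison: the increments of \<open>h\<close> inherit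
  smallness from those of two functions that are known to be absolutely continuous.\<close>

lemma absolutely_continuous_on_dominated:
  fixes g1 :: "real \<Rightarrow> 'a::real_normed_vector" and g2 :: "real \<Rightarrow> 'b::real_normed_vector"
    and h :: "real \<Rightarrow> 'c::real_normed_vector"
  assumes g1: "absolutely_continuous_on S g1" and g2: "absolutely_continuous_on S g2"
    and h: "\<And>u v. \<lbrakk>u \<in> S; v \<in> S; u \<le> v\<rbrakk> \<Longrightarrow>
              norm (h v - h u) \<le> K * (norm (g1 v - g1 u) + norm (g2 v - g2 u))"
  shows "absolutely_continuous_on S h"
  unfolding absolutely_continuous_on_def
proof (intro allI impI)
  fix e :: real
  assume "e > 0"
  define K' where "K' = max K 1"
  have K': "K' > 0" "K \<le> K'" by (auto simp: K'_def)
  define e' where "e' = e / (2 * K')"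
  have "e' > 0" using \<open>e > 0\<close> K' by (simp add: e'_def)
  obtain d1 where d1: "d1 > 0" "\<And>D. D division_of \<Union>D \<Longrightarrow> \<Union>D \<subseteq> S \<Longrightarrow> (\<Sum>k\<in>D. Sup k - Inf k) < d1
      \<Longrightarrow> (\<Sum>k\<in>D. norm (g1 (Sup k) - g1 (Inf k))) < e'"
    using g1 \<open>e' > 0\<close> unfolding absolutely_continuous_on_def by meson
  obtain d2 where d2: "d2 > 0" "\<And>D. D division_of \<Union>D \<Longrightarrow> \<Union>D \<subseteq> S \<Longrightarrow> (\<Sum>k\<in>D. Sup k - Inf k) < d2
      \<Longrightarrow> (\<Sum>k\<in>D. norm (g2 (Sup k) - g2 (Inf k))) < e'"
    using g2 \<open>e' > 0\<close> unfolding absolutely_continuous_on_def by meson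
  show "\<exists>\<delta>>0. \<forall>D. D division_of \<Union>D \<and> \<Union>D \<subseteq> S \<and> (\<Sum>k\<in>D. Sup k - Inf k) < \<delta> \<longrightarrow>
        (\<Sum>k\<in>D. norm (h (Sup k) - h (Inf k))) < e"
  proof (intro exI[of _ "min d1 d2"] conjI allI impI; (elim conjE)?)
    fix D :: "real set set"
    assume D: "D division_of \<Union>D" "\<Union>D \<subseteq> S" "(\<Sum>k\<in>D. Sup k - Inf k) < min d1 d2"
    have "(\<Sum>k\<in>D. norm (h (Sup k) - h (Inf k)))
        \<le> (\<Sum>k\<in>D. K' * (norm (g1 (Sup k) - g1 (Inf k)) + norm (g2 (Sup k) - g2 (Inf k))))"
    proof (rule sum_mono)
      fix k
      assume "k \<in> D"
      then obtain u v where uv: "u \<le> v" "u \<in> S" "v \<in> S" "Sup k = v" "Inf k = u"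
        using division_of_UnionE D by metis
      have "norm (h v - h u) \<le> K * (norm (g1 v - g1 u) + norm (g2 v - g2 u))"
        using h uv by blast
      also have "\<dots> \<le> K' * (norm (g1 v - g1 u) + norm (g2 v - g2 u))"
        using K' by (intro mult_right_mono) auto
      finally show "norm (h (Sup k) - h (Inf k)) \<le>
          K' * (norm (g1 (Sup k) - g1 (Inf k)) + norm (g2 (Sup k) - g2 (Inf k)))"
        by (simp add: uv)
    qed
    also have "\<dots> = K' * ((\<Sum>k\<in>D. norm (g1 (Sup k) - g1 (Inf k))) + (\<Sum>k\<in>D. norm (g2 (Sup k) - g2 (Inf k))))"
      by (simp add: sum.distrib flip: sum_distrib_left)
    also have "\<dots> < K' * (e' + e')"
      using d1(2)[OF D(1,2)] d2(2)[OF D(1,2)] D(3) K' by (intro mult_strict_left_mono) auto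
    also have "\<dots> = e" using K' by (simp add: e'_def field_simps)
    finally show "(\<Sum>k\<in>D. norm (h (Sup k) - h (Inf k))) < e" .
  qed (use d1 d2 in auto)
qed

lemma absolutely_continuous_on_imp_continuous:
  assumes "absolutely_continuous_on {a..b} (g :: real \<Rightarrow> 'a::real_normed_vector)"
  shows "continuous_on {a..b} g"
  unfolding continuous_on_iff
proof (intro ballI allI impI)
  fix x e :: real
  assume x: "x \<in> {a..b}" and "e > 0"
  then obtain d where d: "d > 0" "\<And>D. D division_of \<Union>D \<Longrightarrow> \<Union>D \<subseteq> {a..b} \<Longrightarrow> (\<Sum>k\<in>D. Sup k - Inf k) < d
      \<Longrightarrow> (\<Sum>k\<in>D. norm (g (Sup k) - g (Inf k))) < e"
    using assms unfolding absolutely_continuous_on_def by meson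
  have *: "norm (g v - g u) < e" if "u \<in> {a..b}" "v \<in> {a..b}" "u \<le> v" "v - u < d" for u v
  proof -
    have "{cbox u v} division_of \<Union>{cbox u v}"
      using division_of_self[of u v] that by simp
    then show ?thesis
      using d(2)[of "{cbox u v}"] that by (auto simp: box_real)
  qed
  show "\<exists>d>0. \<forall>x'\<in>{a..b}. dist x' x < d \<longrightarrow> dist (g x') (g x) < e"
  proof (intro exI[of _ d] conjI ballI impI)
    fix y assume "y \<in> {a..b}" "dist y x < d"
    then show "dist (g y) (g x) < e"
      using *[of x y] *[of y x] x by (cases "x \<le> y") (auto simp: dist_norm norm_minus_commute)
  qed fact
qed

lemma absolutely_continuous_on_bounded_linear:
  assumes "bounded_linear L" "absolutely_continuous_on S g"
  shows "absolutely_continuous_on S (\<lambda>t. L (g t))"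
proof -
  interpret bounded_linear L by fact
  obtain K where K: "K > 0" "\<And>x. norm (L x) \<le> norm x * K" using pos_bounded by blast
  have "norm (L (g v) - L (g u)) \<le> K * (norm (g v - g u) + norm (g v - g u))" for u v
  proof -
    have "norm (L (g v) - L (g u)) \<le> K * norm (g v - g u)"
      using K(2)[of "g v - g u"] by (simp add: diff mult.commute)
    also have "\<dots> \<le> K * (norm (g v - g u) + norm (g v - g u))"
      using K by (intro mult_left_mono) auto
    finally show ?thesis .
  qed
  then show ?thesis
    using absolutely_continuous_on_dominated[OF assms(2,2)] by metis
qed

lemma absolutely_continuous_on_add:
  assumes "absolutely_continuous_on S g" "absolutely_continuous_on S h"
  shows "absolutely_continuous_on S (\<lambda>t. g t + h t)"
proof (rule absolutely_continuous_on_dominated[OF assms, where K = 1])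
  show "norm (g v + h v - (g u + h u)) \<le> 1 * (norm (g v - g u) + norm (h v - h u))" for u v
    by (metis add_diff_add mult_1 norm_triangle_ineq)
qed

lemma absolutely_continuous_on_diff:
  assumes "absolutely_continuous_on S g" "absolutely_continuous_on S h"
  shows "absolutely_continuous_on S (\<lambda>t. g t - h t)"
  using absolutely_continuous_on_add[OF assms(1)
      absolutely_continuous_on_bounded_linear[OF bounded_linear_minus[OF bounded_linear_ident] assms(2)]]
  by simp

lemma absolutely_continuous_on_const: "absolutely_continuous_on S (\<lambda>t. c)"
  unfolding absolutely_continuous_on_def by (auto intro: exI[of _ 1])

text \<open>Both factors are bounded on the compact interval, so the usual splitting of the increment of a
  product is a domination.\<close>

lemma absolutely_continuous_on_bilinear:
  fixes g :: "real \<Rightarrow> 'a::real_normed_vector" and h :: "real \<Rightarrow> 'b::real_normed_vector"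
  assumes "bounded_bilinear bp"
    and g: "absolutely_continuous_on {a..b} g" and h: "absolutely_continuous_on {a..b} h"
  shows "absolutely_continuous_on {a..b} (\<lambda>t. bp (g t) (h t))"
proof -
  interpret bounded_bilinear bp by fact
  obtain K where K: "K > 0" "\<And>x y. norm (bp x y) \<le> norm x * norm y * K" using pos_bounded by blast
  obtain G where G: "G > 0" "\<And>t. t \<in> {a..b} \<Longrightarrow> norm (g t) \<le> G"
    using compact_imp_bounded[OF compact_continuous_image[OF absolutely_continuous_on_imp_continuous[OF g]]]
    by (auto simp: bounded_pos)
  obtain H where H: "H > 0" "\<And>t. t \<in> {a..b} \<Longrightarrow> norm (h t) \<le> H"
    using compact_imp_bounded[OF compact_continuous_image[OF absolutely_continuous_on_imp_continuous[OF h]]]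
    by (auto simp: bounded_pos)
  show ?thesis
  proof (rule absolutely_continuous_on_dominated[OF g h, where K = "K * (G + H)"])
    fix u v assume uv: "u \<in> {a..b}" "v \<in> {a..b}"
    have "bp (g v) (h v) - bp (g u) (h u) = bp (g v - g u) (h v) + bp (g u) (h v - h u)"
      by (simp add: diff_left diff_right)
    then have "norm (bp (g v) (h v) - bp (g u) (h u))
        \<le> norm (g v - g u) * norm (h v) * K + norm (g u) * norm (h v - h u) * K"
      using K(2) norm_triangle_mono by metis
    also have "\<dots> \<le> norm (g v - g u) * (G + H) * K + (G + H) * norm (h v - h u) * K"
      using G(2)[of u] H(2)[of v] uv G(1) H(1) K(1)
      by (intro add_mono mult_right_mono mult_left_mono) auto
    finally show "norm (bp (g v) (h v) - bp (g u) (h u))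
        \<le> K * (G + H) * (norm (g v - g u) + norm (h v - h u))"
      by (simp add: algebra_simps)
  qed
qed

text \<open>Truncate \<open>norm f\<close> at a height \<open>n\<close> for which the part above \<open>n\<close> has small integral. The truncated part
  contributes at most \<open>n\<close> times the total length.\<close>

lemma absolutely_continuous_on_indefinite_integral:
  fixes f :: "real \<Rightarrow> 'a::euclidean_space"
  assumes f: "f absolutely_integrable_on {a..b}"
  shows "absolutely_continuous_on {a..b} (\<lambda>t. integral {a..t} f)"
  unfolding absolutely_continuous_on_def
proof (intro allI impI)
  fix e :: real
  assume "e > 0"
  have fi: "f integrable_on {a..b}" and gi: "(\<lambda>t. norm (f t)) integrable_on {a..b}"
    using f by (auto simp: absolutely_integrable_on_def)
  define g where "g n t = min (norm (f t)) (real n)" for n t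
  have gn: "g n integrable_on {a..b}" for n
  proof -
    have "(\<lambda>t. min (norm (f t)) (real n)) absolutely_integrable_on {a..b}"
      using f by (intro absolutely_integrable_min_1 absolutely_integrable_norm[unfolded o_def])
        (auto simp: absolutely_integrable_on_def)
    then show ?thesis by (simp add: g_def[abs_def] absolutely_integrable_on_def)
  qed
  have "(\<lambda>n. integral {a..b} (g n)) \<longlonglongrightarrow> integral {a..b} (\<lambda>t. norm (f t))"
  proof (rule dominated_convergence(2)[OF gn gi])
    show "norm (g n t) \<le> norm (f t)" for n t by (simp add: g_def)
    show "(\<lambda>n. g n t) \<longlonglongrightarrow> norm (f t)" for t
    proof (rule tendsto_eventually)
      obtain N where "norm (f t) \<le> real N" using real_arch_simple by blast
      then show "\<forall>\<^sub>F n in sequentially. g n t = norm (f t)"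
        by (intro eventually_mono[OF eventually_ge_at_top[of N]]) (auto simp: g_def)
    qed
  qed
  then obtain n where n: "\<bar>integral {a..b} (g n) - integral {a..b} (\<lambda>t. norm (f t))\<bar> < e / 2"
    using \<open>e > 0\<close> by (metis LIMSEQ_iff half_gt_zero order_refl real_norm_def)
  let ?h = "\<lambda>t. norm (f t) - g n t"
  have hi: "?h integrable_on {a..b}" and h0: "\<And>t. ?h t \<ge> 0"
    using integrable_diff[OF gi gn] by (auto simp: g_def)
  have hI: "integral {a..b} ?h < e / 2"
    using n unfolding integral_diff[OF gi gn[of n]] by linarith
  show "\<exists>\<delta>>0. \<forall>D. D division_of \<Union>D \<and> \<Union>D \<subseteq> {a..b} \<and> (\<Sum>k\<in>D. Sup k - Inf k) < \<delta> \<longrightarrow>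
        (\<Sum>k\<in>D. norm (integral {a..Sup k} f - integral {a..Inf k} f)) < e"
  proof (intro exI[of _ "e / (2 * (real n + 1))"] conjI allI impI; (elim conjE)?)
    fix D :: "real set set"
    assume D: "D division_of \<Union>D" "\<Union>D \<subseteq> {a..b}" "(\<Sum>k\<in>D. Sup k - Inf k) < e / (2 * (real n + 1))"
    have hD: "?h integrable_on \<Union>D"
      using D hi integrable_on_subdivision by blast
    have "(\<Sum>k\<in>D. norm (integral {a..Sup k} f - integral {a..Inf k} f))
        \<le> (\<Sum>k\<in>D. integral k ?h + real n * (Sup k - Inf k))"
    proof (rule sum_mono)
      fix k assume "k \<in> D"
      then obtain u v where uv: "k = {u..v}" "u \<le> v" "u \<in> {a..b}" "v \<in> {a..b}" "Sup k = v" "Inf k = u"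
        "{u..v} \<subseteq> {a..b}"
        using division_of_UnionE D by metis
      have sub: "f integrable_on {u..v}" "(\<lambda>t. norm (f t)) integrable_on {u..v}" "?h integrable_on {u..v}"
        "g n integrable_on {u..v}" "f integrable_on {a..v}"
        using integrable_on_subinterval[of _ "{a..b}"] fi gi hi gn uv by auto
      have "integral {a..v} f - integral {a..u} f = integral {u..v} f"
        using Henstock_Kurzweil_Integration.integral_combine[of a u v f] sub(5) uv by (auto simp: algebra_simps)
      then have "norm (integral {a..v} f - integral {a..u} f) \<le> integral {u..v} (\<lambda>t. norm (f t))"
        using integral_norm_bound_integral[OF sub(1,2)] by simp
      also have "\<dots> = integral {u..v} ?h + integral {u..v} (g n)"
        using sub by (simp add: integral_diff)
      also have "integral {u..v} (g n) \<le> integral {u..v} (\<lambda>t. real n)"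
        using sub by (intro integral_le) (auto simp: g_def)
      finally show "norm (integral {a..Sup k} f - integral {a..Inf k} f)
          \<le> integral k ?h + real n * (Sup k - Inf k)"
        using uv by (simp add: algebra_simps)
    qed
    also have "\<dots> = integral (\<Union>D) ?h + real n * (\<Sum>k\<in>D. Sup k - Inf k)"
      using integral_combine_division_topdown[OF hD D(1)] by (simp add: sum.distrib sum_distrib_left)
    also have "integral (\<Union>D) ?h \<le> integral {a..b} ?h"
      using D hD hi h0 by (intro integral_subset_le) auto
    also have "real n * (\<Sum>k\<in>D. Sup k - Inf k) \<le> real n * (e / (2 * (real n + 1)))"
      using D(3) by (intro mult_left_mono) auto
    also have "\<dots> \<le> e / 2"
      using \<open>e > 0\<close> by (simp add: field_simps)
    finally show "(\<Sum>k\<in>D. norm (integral {a..Sup k} f - integral {a..Inf k} f)) < e"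
      using hI by simp
  qed (use \<open>e > 0\<close> in auto)
qed

text \<open>The derivative estimate in the two-sided form that a gauge argument uses: \<open>x\<close> is a tag anywhere in
  \<open>{u..v}\<close>, not an end point.\<close>

lemma vector_derivative_straddle:
  fixes g :: "real \<Rightarrow> 'a::real_normed_vector"
  assumes "(g has_vector_derivative D) (at x within S)" "e > 0"
  obtains d where "d > 0"
    "\<And>u v. \<lbrakk>u \<in> S; v \<in> S; u \<le> x; x \<le> v; {u..v} \<subseteq> ball x d\<rbrakk>
        \<Longrightarrow> norm (g v - g u - (v - u) *\<^sub>R D) \<le> e * (v - u)"
proof -
  obtain d where d: "d > 0"
    "\<And>y. y \<in> S \<Longrightarrow> norm (y - x) < d \<Longrightarrow> norm (g y - g x - (y - x) *\<^sub>R D) \<le> e * norm (y - x)"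
    using assms unfolding has_vector_derivative_def has_derivative_within_alt by blast
  show thesis
  proof (rule that[OF \<open>d > 0\<close>])
    fix u v assume uv: "u \<in> S" "v \<in> S" "u \<le> x" "x \<le> v" "{u..v} \<subseteq> ball x d"
    then have "u \<in> ball x d" "v \<in> ball x d" by (auto simp: subset_iff)
    then have "norm (g u - g x - (u - x) *\<^sub>R D) \<le> e * (x - u)" "norm (g v - g x - (v - x) *\<^sub>R D) \<le> e * (v - x)"
      using d(2)[of u] d(2)[of v] uv by (auto simp: dist_real_def)
    moreover have "g v - g u - (v - u) *\<^sub>R D = (g v - g x - (v - x) *\<^sub>R D) - (g u - g x - (u - x) *\<^sub>R D)"
      by (simp add: algebra_simps)
    then have "norm (g v - g u - (v - u) *\<^sub>R D)
        \<le> norm (g v - g x - (v - x) *\<^sub>R D) + norm (g u - g x - (u - x) *\<^sub>R D)"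
      by (metis norm_triangle_ineq4)
    ultimately show "norm (g v - g u - (v - u) *\<^sub>R D) \<le> e * (v - u)"
      by (simp add: algebra_simps)
  qed
qed

text \<open>The increments of \<open>g\<close> over a tagged division telescope to \<open>g b - g a\<close>. Intervals with a tag outside \<open>N\<close>
  are controlled by the derivative there. Intervals with a tag in \<open>N\<close> lie, for a suitable gauge, in an open
  set of small measure around \<open>N\<close>; their total length is small, and absolute continuity makes their
  increments small.\<close>

lemma fundamental_theorem_absolutely_continuous:
  fixes g :: "real \<Rightarrow> 'a::euclidean_space"
  assumes ac: "absolutely_continuous_on {a..b} g" and "a \<le> b" and N: "negligible N"
    and der: "\<And>t. t \<in> {a..b} - N \<Longrightarrow> (g has_vector_derivative g' t) (at t within {a..b})"
  shows "(g' has_integral (g b - g a)) {a..b}"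
proof -
  \<comment> \<open>Tags in \<open>N\<close> then contribute nothing to the Riemann sums.\<close>
  define f where "f t = (if t \<in> N then 0 else g' t)" for t
  have "(f has_integral (g b - g a)) {a..b}"
    unfolding has_integral_real
  proof (intro allI impI)
    fix e :: real
    assume "e > 0"
    define e1 where "e1 = e / (2 * (b - a + 1))"
    have e1: "e1 > 0" "e1 * (b - a) < e / 2"
      using \<open>e > 0\<close> \<open>a \<le> b\<close> by (auto simp: e1_def field_simps add_pos_nonneg)
    obtain d where d: "d > 0" "\<And>D. D division_of \<Union>D \<Longrightarrow> \<Union>D \<subseteq> {a..b} \<Longrightarrow> (\<Sum>k\<in>D. Sup k - Inf k) < d
        \<Longrightarrow> (\<Sum>k\<in>D. norm (g (Sup k) - g (Inf k))) < e / 2"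
      using ac \<open>e > 0\<close> half_gt_zero[of e] unfolding absolutely_continuous_on_def by meson
    obtain G where G: "open G" "N \<subseteq> G" "G \<in> lmeasurable" "measure lebesgue G < d"
    proof -
      have "N \<in> sets lebesgue" "N \<in> lmeasurable" "measure lebesgue N = 0"
        using N by (auto simp: negligible_iff_null_sets negligible_imp_measurable negligible_imp_measure0)
      obtain G where "open G" "N \<subseteq> G" "(G - N) \<in> lmeasurable" "emeasure lebesgue (G - N) < ennreal d"
        using sets_lebesgue_outer_open[OF \<open>N \<in> sets lebesgue\<close> d(1)] by metis
      moreover have "G = (G - N) \<union> N" using \<open>N \<subseteq> G\<close> by auto
      ultimately have "G \<in> lmeasurable" "measure lebesgue G \<le> measure lebesgue (G - N) + measure lebesgue N"
        using \<open>N \<in> lmeasurable\<close> fmeasurable.Un measure_Un_le[of "G - N" lebesgue N]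
        by (metis, metis fmeasurableD)
      moreover have "measure lebesgue (G - N) < d"
        using \<open>emeasure lebesgue (G - N) < ennreal d\<close> \<open>G - N \<in> lmeasurable\<close> d(1)
        by (simp add: emeasure_eq_measure2 ennreal_less_iff)
      ultimately show thesis
        using that[of G] \<open>open G\<close> \<open>N \<subseteq> G\<close> \<open>measure lebesgue N = 0\<close> by simp
    qed
    have "\<exists>r>0. (x \<in> N \<longrightarrow> ball x r \<subseteq> G) \<and> (x \<in> {a..b} - N \<longrightarrow>
        (\<forall>u v. u \<in> {a..b} \<longrightarrow> v \<in> {a..b} \<longrightarrow> u \<le> x \<longrightarrow> x \<le> v \<longrightarrow> {u..v} \<subseteq> ball x r
          \<longrightarrow> norm (g v - g u - (v - u) *\<^sub>R g' x) \<le> e1 * (v - u)))" for x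
    proof (cases "x \<in> N")
      case True
      then show ?thesis using G(1,2) openE by blast
    next
      case False
      show ?thesis
      proof (cases "x \<in> {a..b}")
        case True
        show ?thesis
          using vector_derivative_straddle[OF der e1(1), of x] True False by (smt (verit) DiffI)
      next
        case out: False
        with False show ?thesis by (intro exI[of _ 1]) auto
      qed
    qed
    then obtain r where r: "\<And>x. r x > 0" "\<And>x. x \<in> N \<Longrightarrow> ball x (r x) \<subseteq> G"
      "\<And>x u v. \<lbrakk>x \<in> {a..b} - N; u \<in> {a..b}; v \<in> {a..b}; u \<le> x; x \<le> v; {u..v} \<subseteq> ball x (r x)\<rbrakk>
          \<Longrightarrow> norm (g v - g u - (v - u) *\<^sub>R g' x) \<le> e1 * (v - u)"
      by metis
    show "\<exists>\<gamma>. gauge \<gamma> \<and> (\<forall>p. p tagged_division_of {a..b} \<and> \<gamma> fine p \<longrightarrow>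
        norm ((\<Sum>(x, k)\<in>p. measure lborel k *\<^sub>R f x) - (g b - g a)) < e)"
    proof (intro exI[of _ "\<lambda>x. ball x (r x)"] conjI allI impI; (elim conjE)?)
      show "gauge (\<lambda>x. ball x (r x))"
        using r(1) by (intro gaugeI) auto
    next
      fix p
      assume p: "p tagged_division_of {a..b}" and fine: "(\<lambda>x. ball x (r x)) fine p"
      let ?g = "\<lambda>k. g (Sup k) - g (Inf k)"
      have fin: "finite p" using p by blast
      have pk: "\<exists>u v. k = {u..v} \<and> u \<le> v \<and> u \<le> x \<and> x \<le> v \<and> u \<in> {a..b} \<and> v \<in> {a..b} \<and> x \<in> {a..b}
          \<and> {u..v} \<subseteq> ball x (r x)" if xk: "(x, k) \<in> p" for x k
      proof -
        obtain u v where "k = cbox u v" using tagged_division_ofD(4)[OF p xk] by blast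
        moreover have "x \<in> k" "k \<subseteq> {a..b}" using tagged_division_ofD(2,3)[OF p xk] by auto
        moreover have "k \<subseteq> ball x (r x)" using fine xk by (auto simp: fine_def)
        ultimately show ?thesis by (intro exI[of _ u] exI[of _ v]) (auto simp: subset_iff)
      qed
      have tele: "(\<Sum>(x, k)\<in>p. ?g k) = g b - g a"
        using additive_tagged_division_1[OF \<open>a \<le> b\<close> p, of g] by simp
      define q where "q = {(x, k) \<in> p. x \<in> N}"
      have q: "q \<subseteq> p" by (auto simp: q_def)
      have "(\<Sum>(x, k)\<in>p. measure lborel k *\<^sub>R f x) - (g b - g a)
          = (\<Sum>(x, k)\<in>p. measure lborel k *\<^sub>R f x - ?g k)"
        unfolding tele[symmetric] by (simp add: sum_subtractf case_prod_unfold)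
      also have "\<dots> = (\<Sum>(x, k)\<in>p - q. measure lborel k *\<^sub>R f x - ?g k) + (\<Sum>(x, k)\<in>q. measure lborel k *\<^sub>R f x - ?g k)"
        using sum.subset_diff[OF q fin] .
      finally have split: "(\<Sum>(x, k)\<in>p. measure lborel k *\<^sub>R f x) - (g b - g a)
          = (\<Sum>(x, k)\<in>p - q. measure lborel k *\<^sub>R f x - ?g k) + (\<Sum>(x, k)\<in>q. measure lborel k *\<^sub>R f x - ?g k)" .
      have "norm ((\<Sum>(x, k)\<in>p. measure lborel k *\<^sub>R f x) - (g b - g a))
          \<le> norm (\<Sum>(x, k)\<in>p - q. measure lborel k *\<^sub>R f x - ?g k) + norm (\<Sum>(x, k)\<in>q. measure lborel k *\<^sub>R f x - ?g k)"
        unfolding split by (rule norm_triangle_ineq)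
      moreover have "norm (\<Sum>(x, k)\<in>p - q. measure lborel k *\<^sub>R f x - ?g k) < e / 2"
      proof -
        have "norm (\<Sum>(x, k)\<in>p - q. measure lborel k *\<^sub>R f x - ?g k) \<le> (\<Sum>(x, k)\<in>p - q. e1 * measure lborel k)"
        proof (rule sum_norm_le, clarify)
          fix x k assume xk: "(x, k) \<in> p" "(x, k) \<notin> q"
          then obtain u v where uv: "k = {u..v}" "u \<le> v" "u \<le> x" "x \<le> v" "u \<in> {a..b}" "v \<in> {a..b}" "x \<in> {a..b}"
            "{u..v} \<subseteq> ball x (r x)" using pk by blast
          have "x \<notin> N" using xk by (auto simp: q_def)
          then show "norm (measure lborel k *\<^sub>R f x - ?g k) \<le> e1 * measure lborel k"
            using r(3)[of x u v] uv by (simp add: f_def norm_minus_commute)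
        qed
        also have "\<dots> \<le> (\<Sum>(x, k)\<in>p. e1 * measure lborel k)"
          using fin e1 by (intro sum_mono2) auto
        also have "\<dots> = e1 * (b - a)"
          using additive_content_tagged_division[of p a b] p \<open>a \<le> b\<close>
          by (simp add: case_prod_unfold flip: sum_distrib_left)
        finally show ?thesis using e1 by simp
      qed
      moreover have "norm (\<Sum>(x, k)\<in>q. measure lborel k *\<^sub>R f x - ?g k) < e / 2"
      proof -
        let ?D = "snd ` q"
        have qk: "\<exists>u v. k = {u..v} \<and> u \<le> v \<and> {u..v} \<subseteq> ball x (r x)" if "(x, k) \<in> q" for x k
          using pk[of x k] that q by blast
        have tq: "q tagged_partial_division_of {a..b}"
          using p q tagged_partial_division_subset unfolding tagged_division_of_def by blast
        have D: "?D division_of \<Union>?D"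
          using partial_division_of_tagged_division[OF tq] .
        have Dsub: "\<Union>?D \<subseteq> {a..b}"
          using tq unfolding tagged_partial_division_of_def by fastforce
        have DG: "\<Union>?D \<subseteq> G"
          using qk r(2) by (fastforce simp: q_def)
        have int1: "(\<lambda>x. 1 :: real) integrable_on \<Union>?D"
          using integrable_on_subdivision[OF D _ Dsub, of "\<lambda>x. 1 :: real"] by auto
        have "(\<Sum>k\<in>?D. Sup k - Inf k) = (\<Sum>k\<in>?D. integral k (\<lambda>x. 1))"
          by (intro sum.cong) (auto dest!: qk)
        also have "\<dots> = integral (\<Union>?D) (\<lambda>x. 1)"
          using integral_combine_division_topdown[OF int1 D] by simp
        also have "\<dots> \<le> integral G (\<lambda>x. 1)"
          using DG G(3) int1 by (intro integral_subset_le) (auto simp: lmeasurable_iff_integrable_on)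
        also have "\<dots> = measure lebesgue G"
          using G(3) by (simp add: lmeasure_integral)
        finally have "(\<Sum>k\<in>?D. norm (?g k)) < e / 2"
          using d(2)[OF D Dsub] G(4) by simp
        moreover have "(\<Sum>(x, k)\<in>q. norm (?g k)) = (\<Sum>k\<in>?D. norm (?g k))"
        proof -
          \<comment> \<open>Distinct tags can share a degenerate interval only, where the increment vanishes; the empty set
            has to be treated separately because its \<open>Sup\<close> and \<open>Inf\<close> are arbitrary.\<close>
          let ?h = "\<lambda>k. if k = {} then 0 else norm (?g k)"
          have "(\<Sum>(x, k)\<in>q. norm (?g k)) = (\<Sum>(x, k)\<in>q. ?h k)"
            by (intro sum.cong) (auto dest!: qk)
          also have "\<dots> = (\<Sum>k\<in>?D. ?h k)"
          proof (rule sum.over_tagged_division_lemma)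
            show "q tagged_division_of \<Union>?D"
              using tagged_partial_division_of_Union_self[OF tq] .
            show "?h (cbox u v) = 0" if "box u v = {}" for u v
              using that by auto
          qed
          also have "\<dots> = (\<Sum>k\<in>?D. norm (?g k))"
            by (intro sum.cong) (auto dest!: qk)
          finally show ?thesis .
        qed
        moreover have "norm (\<Sum>(x, k)\<in>q. measure lborel k *\<^sub>R f x - ?g k) \<le> (\<Sum>(x, k)\<in>q. norm (?g k))"
          by (rule sum_norm_le) (auto simp: q_def f_def norm_minus_commute)
        ultimately show ?thesis by simp
      qed
      ultimately show "norm ((\<Sum>(x, k)\<in>p. measure lborel k *\<^sub>R f x) - (g b - g a)) < e"
        by simp
    qed
  qed
  then show ?thesis
    using has_integral_spike[OF N] by (metis (no_types, lifting) DiffD2 f_def)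
qed


section \<open>Derivatives almost everywhere\<close>

lemma AE_lebesgue_on_iff_negligible:
  assumes "S \<in> sets lebesgue"
  shows "(AE t in lebesgue_on S. P t) \<longleftrightarrow> (\<exists>N. negligible N \<and> (\<forall>t\<in>S - N. P t))"
proof -
  have "(AE t in lebesgue_on S. P t) \<longleftrightarrow> (AE t in lebesgue. t \<in> S \<longrightarrow> P t)"
    using assms by (intro AE_restrict_space_iff) auto
  also have "\<dots> \<longleftrightarrow> {t. \<not> (t \<in> S \<longrightarrow> P t)} \<in> null_sets lebesgue"
    using completion.AE_iff_null_sets[of "\<lambda>t. t \<in> S \<longrightarrow> P t" lborel] by simp
  also have "\<dots> \<longleftrightarrow> negligible (S \<inter> {t. \<not> P t})"
    by (simp add: negligible_iff_null_sets Int_def conj_commute)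
  also have "\<dots> \<longleftrightarrow> (\<exists>N. negligible N \<and> (\<forall>t\<in>S - N. P t))"
    by (rule iffI, rule exI[of _ "S \<inter> {t. \<not> P t}"], simp) (auto intro: negligible_subset)
  finally show ?thesis .
qed

lemma ode_solution_iff:
  "ode_solution rhs x \<longleftrightarrow> (\<forall>T\<ge>0. absolutely_continuous_on {0..T} x) \<and>
     (\<exists>N. negligible N \<and> (\<forall>t\<ge>0. t \<notin> N \<longrightarrow>
        (x has_vector_derivative rhs t (x t)) (at t within {0..})))"
  unfolding ode_solution_def by (subst AE_lebesgue_on_iff_negligible) auto

lemma ode_solution_absolutely_continuous:
  "ode_solution rhs x \<Longrightarrow> absolutely_continuous_on {0..T} x"
  by (cases "T \<ge> 0") (auto simp: ode_solution_def absolutely_continuous_on_def division_of_def)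

lemma has_integral_ode:
  fixes x :: "real \<Rightarrow> 'a::euclidean_space"
  assumes x: "\<And>T. T \<ge> 0 \<Longrightarrow> absolutely_continuous_on {0..T} x" and N: "negligible N"
    and der: "\<And>t. t \<ge> 0 \<Longrightarrow> t \<notin> N \<Longrightarrow> (x has_vector_derivative x' t) (at t within {0..})"
    and "T \<ge> 0"
  shows "(x' has_integral (x T - x 0)) {0..T}"
proof (rule fundamental_theorem_absolutely_continuous[OF x[OF \<open>T \<ge> 0\<close>] \<open>T \<ge> 0\<close> N])
  show "(x has_vector_derivative x' t) (at t within {0..T})" if "t \<in> {0..T} - N" for t
    using der[of t] that by (auto intro: has_vector_derivative_within_subset)
qed

text \<open>Lebesgue's differentiation theorem on the half-line. The averages over \<open>[x, x + s]\<close> converge almost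
  everywhere by \<open>integrable_ccontinuous_explicit\<close>, which gives right derivatives; the same applied to the reflected
  function gives left derivatives.\<close>

lemma indefinite_integral_derivative_ae:
  fixes f :: "real \<Rightarrow> 'a::euclidean_space"
  assumes f: "\<And>T. f integrable_on {0..T}"
  obtains N where "negligible N"
    "\<And>t. t > 0 \<Longrightarrow> t \<notin> N \<Longrightarrow> ((\<lambda>t. integral {0..t} f) has_vector_derivative f t) (at t)"
proof -
  define h where "h t = (if t \<in> {0..} then f t else 0)" for t
  have h: "h integrable_on {a..b}" for a b
  proof -
    have "h integrable_on {0..max 0 b}"
      using f[of "max 0 b"] by (rule integrable_eq) (auto simp: h_def)
    moreover have "h integrable_on {min 0 a..0}"
      by (rule integrable_spike_finite[of "{0}" _ h "\<lambda>x. 0"]) (auto simp: h_def)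
    ultimately have "h integrable_on {min 0 a..max 0 b}"
      using Henstock_Kurzweil_Integration.integrable_combine[of "min 0 a" 0 "max 0 b" h] by auto
    then show ?thesis
      by (rule integrable_on_subinterval) auto
  qed
  define H where "H t = integral {0..t} f" for t
  have H: "integral {u..v} h = H v - H u" if "0 \<le> u" "u \<le> v" for u v
  proof -
    have "integral {u..v} h = integral {u..v} f"
      using that by (intro integral_cong) (auto simp: h_def)
    then show ?thesis
      using Henstock_Kurzweil_Integration.integral_combine[of 0 u v f] f that by (simp add: H_def algebra_simps)
  qed
  obtain N1 where N1: "negligible N1"
    "\<And>x e. x \<notin> N1 \<Longrightarrow> 0 < e \<Longrightarrow> \<exists>d>0. \<forall>s. 0 < s \<and> s < d \<longrightarrow> norm (integral {x..x + s} h /\<^sub>R s - h x) < e"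
    using integrable_ccontinuous_explicit[of h] h by (auto simp: box_real)
  have "(\<lambda>t. h (- t)) integrable_on {a..b}" for a b
    using h[of "- b" "- a"] Henstock_Kurzweil_Integration.integrable_reflect_real[where f = h and a = "- b" and b = "- a"] by simp
  then obtain N2 where N2: "negligible N2"
    "\<And>x e. x \<notin> N2 \<Longrightarrow> 0 < e \<Longrightarrow>
        \<exists>d>0. \<forall>s. 0 < s \<and> s < d \<longrightarrow> norm (integral {x..x + s} (\<lambda>t. h (- t)) /\<^sub>R s - h (- x)) < e"
    using integrable_ccontinuous_explicit[of "\<lambda>t. h (- t)"] by (auto simp: box_real)
  show thesis
  proof (rule that)
    show "negligible (N1 \<union> uminus ` N2)"
      using N1(1) N2(1)
      by (intro negligible_Un negligible_differentiable_image_negligible linear_imp_differentiable_on)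
        (auto simp: linear_uminus)
    fix t :: real
    assume t: "t > 0" "t \<notin> N1 \<union> uminus ` N2"
    then have t': "t \<notin> N1" "- t \<notin> N2" by (auto simp: image_iff)
    have ht: "h t = f t" using t by (simp add: h_def)
    have key: "norm (I - s *\<^sub>R f t) \<le> e * s"
      if "norm (I /\<^sub>R s - f t) < e" "s > 0" for I s e
    proof -
      have "I - s *\<^sub>R f t = s *\<^sub>R (I /\<^sub>R s - f t)" using that by (simp add: algebra_simps)
      then have "norm (I - s *\<^sub>R f t) = s * norm (I /\<^sub>R s - f t)" using that by simp
      also have "\<dots> \<le> s * e" using that by (intro mult_left_mono) auto
      finally show ?thesis by (simp add: mult.commute)
    qed
    show "((\<lambda>t. integral {0..t} f) has_vector_derivative f t) (at t)"
      unfolding has_vector_derivative_def has_derivative_at_alt H_def[symmetric]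
    proof (intro conjI allI impI)
      show "bounded_linear (\<lambda>x. x *\<^sub>R f t)" by (rule bounded_linear_scaleR_left)
      fix e :: real
      assume "e > 0"
      obtain d1 where d1: "d1 > 0" "\<And>s. 0 < s \<Longrightarrow> s < d1 \<Longrightarrow> norm (integral {t..t + s} h /\<^sub>R s - f t) < e"
        using N1(2)[OF t'(1) \<open>e > 0\<close>] ht by auto
      obtain d2 where d2: "d2 > 0"
        "\<And>s. 0 < s \<Longrightarrow> s < d2 \<Longrightarrow> norm (integral {- t..- t + s} (\<lambda>t. h (- t)) /\<^sub>R s - f t) < e"
        using N2(2)[OF t'(2) \<open>e > 0\<close>] ht by auto
      have refl: "integral {- t..- t + s} (\<lambda>t. h (- t)) = integral {t - s..t} h" for s
        using Henstock_Kurzweil_Integration.integral_reflect_real[where f = h and a = "t - s" and b = t] by simp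
      show "\<exists>d>0. \<forall>y. norm (y - t) < d \<longrightarrow> norm (H y - H t - (y - t) *\<^sub>R f t) \<le> e * norm (y - t)"
      proof (intro exI[of _ "min t (min d1 d2)"] conjI allI impI)
        fix y
        assume y: "norm (y - t) < min t (min d1 d2)"
        then have "y > 0" by auto
        consider "y = t" | "y > t" | "y < t" by linarith
        then show "norm (H y - H t - (y - t) *\<^sub>R f t) \<le> e * norm (y - t)"
        proof cases
          case 2
          then show ?thesis
            using key[OF d1(2)[of "y - t"]] y t H[of t y] by auto
        next
          case 3
          have "norm (integral {y..t} h - (t - y) *\<^sub>R f t) \<le> e * (t - y)"
            using key[OF d2(2)[of "t - y"]] y refl[of "t - y"] 3 by auto
          moreover have "H y - H t - (y - t) *\<^sub>R f t = - (H t - H y - (t - y) *\<^sub>R f t)"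
            by (simp add: algebra_simps)
          then have "norm (H y - H t - (y - t) *\<^sub>R f t) = norm (H t - H y - (t - y) *\<^sub>R f t)"
            by (metis norm_minus_cancel)
          ultimately show ?thesis
            using H[of y t] 3 \<open>y > 0\<close> by simp
        qed simp
      qed (use t d1 d2 in auto)
    qed
  qed
qed



section \<open>Linear Caratheodory equations\<close>

lemma continuous_on_compose_max_zero:
  fixes H :: "real \<Rightarrow> 'a::topological_space"
  assumes "\<And>T. continuous_on {0..T} H"
  shows "continuous_on UNIV (\<lambda>t. H (max 0 t))"
proof -
  have "isCont (\<lambda>t. H (max 0 t)) t" for t
  proof -
    have "continuous_on {..<\<bar>t\<bar> + 1} (\<lambda>t. H (max 0 t))"
      by (rule continuous_on_compose2[OF assms[of "\<bar>t\<bar> + 1"]]) (auto intro!: continuous_intros)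
    then show ?thesis
      by (simp add: continuous_on_eq_continuous_at)
  qed
  then show ?thesis by (simp add: continuous_at_imp_continuous_on)
qed

lemma absolutely_integrable_bilinear_continuous:
  fixes bp :: "'b::euclidean_space \<Rightarrow> 'a::euclidean_space \<Rightarrow> 'c::euclidean_space"
  assumes bp: "bounded_bilinear bp" and F: "F absolutely_integrable_on {a..b}"
    and c: "continuous_on {a..b} c"
  shows "(\<lambda>s. bp (F s) (c s)) absolutely_integrable_on {a..b::real}"
proof -
  have "bilinear (\<lambda>y x. bp x y)"
    using bounded_bilinear.flip[OF bp] by (simp add: bilinear_conv_bounded_bilinear)
  moreover have "c \<in> borel_measurable (lebesgue_on {a..b})"
    using c by (intro continuous_imp_measurable_on_sets_lebesgue) auto
  moreover have "bounded (c ` {a..b})"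
    using c by (intro compact_imp_bounded compact_continuous_image) auto
  ultimately show ?thesis
    using F by (intro absolutely_integrable_bounded_measurable_product[of "\<lambda>y x. bp x y"]) auto
qed

lemma absolutely_continuous_on_exp:
  fixes m :: "real \<Rightarrow> real"
  assumes m: "absolutely_continuous_on {a..b} m"
  shows "absolutely_continuous_on {a..b} (\<lambda>t. exp (m t))"
proof -
  obtain M where "\<And>t. t \<in> {a..b} \<Longrightarrow> \<bar>m t\<bar> \<le> M"
    using compact_imp_bounded[OF compact_continuous_image[OF absolutely_continuous_on_imp_continuous[OF m]]]
    by (auto simp: bounded_iff simp del: atLeastAtMost_iff)
  then have M: "\<And>t. t \<in> {a..b} \<Longrightarrow> m t \<le> M"
    using abs_le_D1 by blast
  have "norm (exp (m v) - exp (m u)) \<le> exp M * (norm (m v - m u) + norm (m v - m u))"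
    if "u \<in> {a..b}" "v \<in> {a..b}" for u v
  proof -
    have *: "exp y - exp x \<le> exp M * (y - x)" if "x \<le> y" "y \<le> M" for x y :: real
    proof -
      have "1 + (x - y) \<le> exp (x - y)" by (rule exp_ge_add_one_self)
      then have "exp y * (1 - exp (x - y)) \<le> exp y * (y - x)"
        by (intro mult_left_mono) (linarith, simp)
      also have "\<dots> \<le> exp M * (y - x)" using that by (intro mult_right_mono) auto
      finally show ?thesis by (simp add: algebra_simps flip: exp_add)
    qed
    have "norm (exp (m v) - exp (m u)) \<le> exp M * norm (m v - m u)"
    proof (cases "m u \<le> m v")
      case True
      then show ?thesis using *[of "m u" "m v"] M[OF that(2)] by simp
    next
      case False
      then show ?thesis using *[of "m v" "m u"] M[OF that(1)] by simp
    qed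
    also have "\<dots> \<le> exp M * (norm (m v - m u) + norm (m v - m u))"
      by (intro mult_left_mono) auto
    finally show ?thesis .
  qed
  then show ?thesis
    by (rule absolutely_continuous_on_dominated[OF m m])
qed

text \<open>The integral operator of the equation is a contraction with constant 1/2 in the weighted norm
  \<open>sup exp (- m t) * norm (y t)\<close>, where \<open>m' = 2 K norm F\<close>: the factor 2 in the weight beats the Lipschitz
  constant \<open>K norm F\<close> of the right-hand side at each time. This yields the solution on the whole
  half-line at once, without gluing local solutions. The unknown of the fixed point problem is the
  bounded function \<open>exp (- m t) * y t\<close>, continued to negative times by its value at 0.\<close>

lemma linear_ode_exists:
  fixes bp :: "'b::euclidean_space \<Rightarrow> 'a::euclidean_space \<Rightarrow> 'a"
  assumes bp: "bounded_bilinear bp" and F: "\<And>T. F absolutely_integrable_on {0..T}"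
  shows "\<exists>y. ode_solution (\<lambda>t. bp (F t)) y \<and> y 0 = y0"
proof -
  interpret bounded_bilinear bp by fact
  obtain K where K: "K > 0" "\<And>x y. norm (bp x y) \<le> norm x * norm y * K" using pos_bounded by blast
  define \<phi> where "\<phi> t = 2 * K * norm (F t)" for t
  define m where "m t = integral {0..t} \<phi>" for t
  have \<phi>: "\<phi> absolutely_integrable_on {0..T}" for T
    unfolding \<phi>_def using F[of T] by (intro set_integrable_mult_right set_integrable_norm)
  then have \<phi>i: "\<phi> integrable_on {0..T}" for T by (simp add: absolutely_integrable_on_def)
  have m0: "m t \<ge> 0" for t
    unfolding m_def using K by (intro integral_nonneg \<phi>i) (auto simp: \<phi>_def)
  have mac: "absolutely_continuous_on {0..T} m" for T
    unfolding m_def by (rule absolutely_continuous_on_indefinite_integral[OF \<phi>])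
  have wac: "absolutely_continuous_on {0..T} (\<lambda>t. exp (m t))" for T
    by (rule absolutely_continuous_on_exp[OF mac])
  have mcont: "continuous_on {0..T} m" for T
    using mac by (rule absolutely_continuous_on_imp_continuous)
  obtain N where N: "negligible N" "\<And>t. t > 0 \<Longrightarrow> t \<notin> N \<Longrightarrow> (m has_vector_derivative \<phi> t) (at t)"
    using indefinite_integral_derivative_ae[OF \<phi>i] unfolding m_def by blast
  have wint: "((\<lambda>t. \<phi> t * exp (m t)) has_integral (exp (m T) - 1)) {0..T}" if "T \<ge> 0" for T
  proof -
    have "((\<lambda>t. exp (m t)) has_vector_derivative \<phi> t * exp (m t)) (at t within {0..})"
      if "t \<ge> 0" "t \<notin> insert 0 N" for t
    proof -
      have "(m has_real_derivative \<phi> t) (at t)"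
        using N(2)[of t] that by (simp add: has_real_derivative_iff_has_vector_derivative)
      then have "((\<lambda>t. exp (m t)) has_real_derivative exp (m t) * \<phi> t) (at t)"
        by (rule DERIV_fun_exp)
      then show ?thesis
        by (simp add: has_real_derivative_iff_has_vector_derivative has_vector_derivative_at_within mult.commute)
    qed
    then have "((\<lambda>t. \<phi> t * exp (m t)) has_integral (exp (m T) - exp (m 0))) {0..T}"
      using wac N(1) that by (intro has_integral_ode[where N = "insert 0 N"]) auto
    then show ?thesis by (simp add: m_def)
  qed
  have Gint: "(\<lambda>s. bp (F s) (exp (m s) *\<^sub>R c s)) absolutely_integrable_on {0..T}"
    if "continuous_on {0..T} c" for c T
    by (intro absolutely_integrable_bilinear_continuous[OF bp F] continuous_intros mcont that)
  \<comment> \<open>Up to the factor \<open>exp (m t)\<close>, this is the bound of the integral operator by 1/2 in the weighted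
    norm.\<close>
  have est: "norm (integral {0..t} (\<lambda>s. bp (F s) (exp (m s) *\<^sub>R c s))) \<le> B / 2 * (exp (m t) - 1)"
    if "t \<ge> 0" "continuous_on {0..t} c" "\<And>s. norm (c s) \<le> B" for t c B
  proof -
    have "((\<lambda>s. B / 2 * (\<phi> s * exp (m s))) has_integral (B / 2 * (exp (m t) - 1))) {0..t}"
      using wint[OF that(1)] by (rule has_integral_mult_right)
    then have *: "(\<lambda>s. B / 2 * (\<phi> s * exp (m s))) integrable_on {0..t}"
      "integral {0..t} (\<lambda>s. B / 2 * (\<phi> s * exp (m s))) = B / 2 * (exp (m t) - 1)"
      by (rule has_integral_integrable, rule integral_unique)
    have "norm (integral {0..t} (\<lambda>s. bp (F s) (exp (m s) *\<^sub>R c s)))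
        \<le> integral {0..t} (\<lambda>s. B / 2 * (\<phi> s * exp (m s)))"
    proof (rule integral_norm_bound_integral[OF _ *(1)])
      show "(\<lambda>s. bp (F s) (exp (m s) *\<^sub>R c s)) integrable_on {0..t}"
        using Gint[OF that(2)] by (simp add: absolutely_integrable_on_def)
      fix s
      have "norm (bp (F s) (exp (m s) *\<^sub>R c s)) \<le> norm (F s) * (exp (m s) * norm (c s)) * K"
        using K(2)[of "F s" "exp (m s) *\<^sub>R c s"] by simp
      also have "\<dots> \<le> norm (F s) * (exp (m s) * B) * K"
        using K that(3) by (intro mult_right_mono mult_left_mono) auto
      finally show "norm (bp (F s) (exp (m s) *\<^sub>R c s)) \<le> B / 2 * (\<phi> s * exp (m s))"
        by (simp add: \<phi>_def algebra_simps)
    qed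
    then show ?thesis unfolding *(2) .
  qed
  define \<Phi> where "\<Phi> c t = exp (- m t) *\<^sub>R (y0 + integral {0..t} (\<lambda>s. bp (F s) (exp (m s) *\<^sub>R c s)))" for c t
  have ccont: "continuous_on A (apply_bcontfun c)" for A and c :: "real \<Rightarrow>\<^sub>C 'a"
    using continuous_on_subset continuous_on_apply_bcontfun by blast
  have cint: "(\<lambda>s. bp (F s) (exp (m s) *\<^sub>R apply_bcontfun c s)) absolutely_integrable_on {0..T}" for c T
    by (rule Gint[OF ccont])
  have decay: "exp (- m t) * (B / 2 * (exp (m t) - 1)) \<le> B / 2" if "B \<ge> 0" for B t
    using that by (simp add: field_simps exp_minus)
  have \<Phi>bc: "(\<lambda>t. \<Phi> (apply_bcontfun c) (max 0 t)) \<in> bcontfun" for c :: "real \<Rightarrow>\<^sub>C 'a"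
  proof (rule bcontfun_normI)
    show "continuous_on UNIV (\<lambda>t. \<Phi> (apply_bcontfun c) (max 0 t))"
    proof (rule continuous_on_compose_max_zero)
      show "continuous_on {0..T} (\<Phi> (apply_bcontfun c))" for T
        unfolding \<Phi>_def
        by (intro continuous_intros mcont indefinite_integral_continuous_1)
          (use cint in \<open>auto simp: absolutely_integrable_on_def\<close>)
    qed
    show "norm (\<Phi> (apply_bcontfun c) (max 0 t)) \<le> norm y0 + norm c / 2" for t
    proof -
      define u where "u = max 0 t"
      have "u \<ge> 0" unfolding u_def by (rule max.cobounded1)
      have "norm (\<Phi> (apply_bcontfun c) u)
          \<le> exp (- m u) * (norm y0 + norm (integral {0..u} (\<lambda>s. bp (F s) (exp (m s) *\<^sub>R apply_bcontfun c s))))"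
        by (simp add: \<Phi>_def norm_triangle_ineq)
      also have "\<dots> \<le> exp (- m u) * (norm y0 + norm c / 2 * (exp (m u) - 1))"
        by (intro mult_left_mono add_left_mono est \<open>u \<ge> 0\<close> ccont norm_bounded) auto
      also have "\<dots> \<le> norm y0 + norm c / 2"
        using decay[of "norm c" u] mult_right_mono[of "exp (- m u)" 1 "norm y0"] m0[of u]
        by (simp add: distrib_left)
      finally show ?thesis by (simp add: u_def)
    qed
  qed
  define \<Psi> where "\<Psi> c = Bcontfun (\<lambda>t. \<Phi> (apply_bcontfun c) (max 0 t))" for c
  have \<Psi>: "apply_bcontfun (\<Psi> c) t = \<Phi> (apply_bcontfun c) (max 0 t)" for c t
    unfolding \<Psi>_def using \<Phi>bc by (simp add: Bcontfun_inverse)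
  have "\<exists>!c. \<Psi> c = c"
  proof (rule banach_fix_type[of "1/2"]; (intro allI)?)
    fix c1 c2
    show "dist (\<Psi> c1) (\<Psi> c2) \<le> 1 / 2 * dist c1 c2"
    proof (rule dist_bound)
      fix t :: real
      define u where "u = max 0 t"
      have "u \<ge> 0" unfolding u_def by (rule max.cobounded1)
      have "\<Phi> (apply_bcontfun c1) u - \<Phi> (apply_bcontfun c2) u
          = exp (- m u) *\<^sub>R (integral {0..u} (\<lambda>s. bp (F s) (exp (m s) *\<^sub>R apply_bcontfun c1 s))
              - integral {0..u} (\<lambda>s. bp (F s) (exp (m s) *\<^sub>R apply_bcontfun c2 s)))"
        by (simp add: \<Phi>_def algebra_simps)
      also have "\<dots> = exp (- m u) *\<^sub>R integral {0..u} (\<lambda>s. bp (F s) (exp (m s) *\<^sub>R (apply_bcontfun c1 s - apply_bcontfun c2 s)))"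
        using cint[where c = c1 and T = u] cint[where c = c2 and T = u]
        by (subst integral_diff[symmetric]) (auto simp: absolutely_integrable_on_def diff_right scaleR_diff_right)
      finally have "norm (\<Phi> (apply_bcontfun c1) u - \<Phi> (apply_bcontfun c2) u)
          = exp (- m u) * norm (integral {0..u} (\<lambda>s. bp (F s) (exp (m s) *\<^sub>R (apply_bcontfun c1 s - apply_bcontfun c2 s))))"
        by simp
      also have "\<dots> \<le> exp (- m u) * (dist c1 c2 / 2 * (exp (m u) - 1))"
        by (intro mult_left_mono est \<open>u \<ge> 0\<close> continuous_intros ccont) (auto simp: dist_bounded simp flip: dist_norm)
      also have "\<dots> \<le> dist c1 c2 / 2" by (rule decay) simp
      finally show "dist (apply_bcontfun (\<Psi> c1) t) (apply_bcontfun (\<Psi> c2) t) \<le> 1 / 2 * dist c1 c2"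
        by (simp add: \<Psi> u_def dist_norm)
    qed
  qed auto
  then obtain c where c: "\<Psi> c = c" by blast
  define y where "y t = y0 + integral {0..t} (\<lambda>s. bp (F s) (exp (m s) *\<^sub>R apply_bcontfun c s))" for t
  have y: "exp (m t) *\<^sub>R apply_bcontfun c t = y t" if "t \<ge> 0" for t
  proof -
    have "apply_bcontfun c t = exp (- m t) *\<^sub>R y t"
      using \<Psi>[of c t] c that by (simp add: \<Phi>_def y_def max_def)
    then show ?thesis by (simp flip: exp_add)
  qed
  obtain N' where N': "negligible N'"
    "\<And>t. t > 0 \<Longrightarrow> t \<notin> N' \<Longrightarrow> ((\<lambda>t. integral {0..t} (\<lambda>s. bp (F s) (exp (m s) *\<^sub>R apply_bcontfun c s)))
        has_vector_derivative bp (F t) (exp (m t) *\<^sub>R apply_bcontfun c t)) (at t)"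
    using indefinite_integral_derivative_ae[of "\<lambda>s. bp (F s) (exp (m s) *\<^sub>R apply_bcontfun c s)"] cint
    by (auto simp: absolutely_integrable_on_def)
  have "ode_solution (\<lambda>t. bp (F t)) y"
    unfolding ode_solution_iff
  proof (intro conjI allI impI exI[of _ "insert 0 N'"])
    show "absolutely_continuous_on {0..T} y" for T
      unfolding y_def
      by (intro absolutely_continuous_on_add absolutely_continuous_on_const
          absolutely_continuous_on_indefinite_integral cint)
    show "negligible (insert 0 N')" using N' by simp
    show "(y has_vector_derivative bp (F t) (y t)) (at t within {0..})" if "t \<ge> 0" "t \<notin> insert 0 N'" for t
    proof -
      have "(y has_vector_derivative 0 + bp (F t) (exp (m t) *\<^sub>R apply_bcontfun c t)) (at t)"
        unfolding y_def[abs_def] using that by (intro has_vector_derivative_add has_vector_derivative_const N') auto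
      then show ?thesis
        using y[OF that(1)] by (simp add: has_vector_derivative_at_within)
    qed
  qed
  moreover have "y 0 = y0" by (simp add: y_def)
  ultimately show ?thesis by blast
qed


section \<open>Products of solutions and functions along a control\<close>

lemma bounded_bilinear_matrix_vector_mult:
  "bounded_bilinear ((*v) :: real^'n^'m \<Rightarrow> real^'n \<Rightarrow> real^'m)"
  by (auto simp: bilinear_def algebra_simps scaleR_matrix_vector_assoc intro!: linearI
      simp flip: bilinear_conv_bounded_bilinear)

lemma bounded_bilinear_vector_matrix_mult:
  "bounded_bilinear ((v*) :: real^'m \<Rightarrow> real^'n^'m \<Rightarrow> real^'n)"
  by (auto simp: bilinear_def algebra_simps scaleR_vector_matrix_assoc vector_scaleR_matrix_ac intro!: linearI
      simp flip: bilinear_conv_bounded_bilinear)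

lemma bounded_bilinear_matrix_matrix_mult:
  "bounded_bilinear ((**) :: real^'n^'m \<Rightarrow> real^'k^'n \<Rightarrow> real^'k^'m)"
proof -
  have "(A + B) ** X = A ** X + B ** X" for A B :: "real^'n^'m" and X :: "real^'k^'n"
    by (vector matrix_matrix_mult_def sum.distrib distrib_right)
  then show ?thesis
    by (auto simp: bilinear_def matrix_add_ldistrib scalar_matrix_assoc matrix_scalar_ac
        intro!: linearI simp flip: bilinear_conv_bounded_bilinear)
qed

lemma ode_solution_cong:
  assumes "\<And>t y. t \<ge> 0 \<Longrightarrow> rhs t y = rhs' t y"
  shows "ode_solution rhs x \<longleftrightarrow> ode_solution rhs' x"
  using assms by (simp add: ode_solution_iff)

lemma ode_solutionE:
  assumes "ode_solution rhs x"
  obtains N where "negligible N"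
    "\<And>t. t \<ge> 0 \<Longrightarrow> t \<notin> N \<Longrightarrow> (x has_vector_derivative rhs t (x t)) (at t within {0..})"
  using assms unfolding ode_solution_iff by blast

text \<open>Integrating the product rule. All conserved quantities and representation formulas below are
  instances for one of the three matrix products.\<close>

lemma has_integral_ode_product:
  fixes bp :: "'a::euclidean_space \<Rightarrow> 'b::euclidean_space \<Rightarrow> 'c::euclidean_space"
  assumes bp: "bounded_bilinear bp" and x: "ode_solution rhs x" and y: "ode_solution rhs' y" and "T \<ge> 0"
  shows "((\<lambda>t. bp (x t) (rhs' t (y t)) + bp (rhs t (x t)) (y t)) has_integral
            (bp (x T) (y T) - bp (x 0) (y 0))) {0..T}"
proof -
  obtain N where N: "negligible N"
    "\<And>t. t \<ge> 0 \<Longrightarrow> t \<notin> N \<Longrightarrow> (x has_vector_derivative rhs t (x t)) (at t within {0..})"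
    using ode_solutionE[OF x] by blast
  obtain N' where N': "negligible N'"
    "\<And>t. t \<ge> 0 \<Longrightarrow> t \<notin> N' \<Longrightarrow> (y has_vector_derivative rhs' t (y t)) (at t within {0..})"
    using ode_solutionE[OF y] by blast
  show ?thesis
  proof (rule has_integral_ode[where N = "N \<union> N'", OF _ _ _ \<open>T \<ge> 0\<close>])
    show "absolutely_continuous_on {0..T} (\<lambda>t. bp (x t) (y t))" for T
      by (intro absolutely_continuous_on_bilinear[OF bp] ode_solution_absolutely_continuous[OF x]
          ode_solution_absolutely_continuous[OF y])
    show "negligible (N \<union> N')" using N N' by simp
    show "((\<lambda>t. bp (x t) (y t)) has_vector_derivative bp (x t) (rhs' t (y t)) + bp (rhs t (x t)) (y t))
            (at t within {0..})" if "t \<ge> 0" "t \<notin> N \<union> N'" for t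
      using that N(2)[of t] N'(2)[of t] by (intro bounded_bilinear.has_vector_derivative[OF bp]) auto
  qed
qed

lemma gradient_eqI:
  assumes "GDERIV g x :> D"
  shows "gradient g x = D"
  unfolding gradient_def
proof (rule the_equality)
  show "GDERIV g x :> D" by fact
next
  fix D'
  assume "GDERIV g x :> D'"
  then have "(\<lambda>h. inner h D') = (\<lambda>h. inner h D)"
    using assms unfolding gderiv_def by (rule has_derivative_unique)
  then show "D' = D" by (metis inner_commute vector_eq_ldot)
qed

text \<open>A control is bounded on \<open>{0..T}\<close>, so the local bound of \<open>g\<close> applies with one radius.\<close>

lemma integrable_along_control:
  fixes g :: "'a::real_normed_vector \<Rightarrow> 'u::euclidean_space \<Rightarrow> real \<Rightarrow> 'b::euclidean_space"
  assumes g: "locally_bounded_lipschitz g" and u: "u \<in> admissible_controls U"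
    and car: "caratheodory (\<lambda>t x. g x (u t) t)"
  shows "(\<lambda>t. g 0 (u t) t) absolutely_integrable_on {0..T}"
proof (cases "T \<ge> 0")
  case True
  obtain r where r: "r > 0" "\<And>t. t \<in> {0..T} \<Longrightarrow> norm (u t) \<le> r"
    using u True unfolding admissible_controls_def by (auto simp: bounded_pos simp del: atLeastAtMost_iff)
  obtain M L where M: "locally_integrable M" and
    "AE t in lebesgue_on {0..}. \<forall>v x y. norm v \<le> r \<and> norm x \<le> r \<and> norm y \<le> r \<longrightarrow>
           norm (g x v t) \<le> M t \<and> norm (g x v t - g y v t) \<le> L t * norm (x - y)"
    using g unfolding locally_bounded_lipschitz_def by meson
  then obtain N where N: "negligible N" "\<forall>t\<in>{0..} - N. \<forall>v x y. norm v \<le> r \<and> norm x \<le> r \<and> norm y \<le> r \<longrightarrow>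
           norm (g x v t) \<le> M t \<and> norm (g x v t - g y v t) \<le> L t * norm (x - y)"
    by (subst (asm) AE_lebesgue_on_iff_negligible) auto
  have meas: "(\<lambda>t. g 0 (u t) t) \<in> borel_measurable (lebesgue_on {0..})"
    using car unfolding caratheodory_def by blast
  show ?thesis
  proof (rule set_integrable_bound)
    show "M absolutely_integrable_on {0..T}"
      using M True by (simp add: locally_integrable_def)
    have "(\<lambda>t. g 0 (u t) t) \<in> borel_measurable (lebesgue_on {0..T})"
      using meas by (rule measurable_restrict_mono) auto
    then show "set_borel_measurable lebesgue {0..T} (\<lambda>t. g 0 (u t) t)"
      unfolding set_borel_measurable_def by (subst (asm) borel_measurable_restrict_space_iff) auto
    have "AE t in lebesgue_on {0..T}. norm (g 0 (u t) t) \<le> norm (M t)"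
    proof (rule AE_lebesgue_on_iff_negligible[THEN iffD2, OF _ exI, OF _ conjI[OF N(1)]])
      show "\<forall>t\<in>{0..T} - N. norm (g 0 (u t) t) \<le> norm (M t)"
      proof
        fix t
        assume "t \<in> {0..T} - N"
        then show "norm (g 0 (u t) t) \<le> norm (M t)"
          using N(2)[rule_format, of t "u t" 0 0] r(1) r(2)[of t] by auto
      qed
    qed simp
    then show "AE t in lebesgue. t \<in> {0..T} \<longrightarrow> norm (g 0 (u t) t) \<le> norm (M t)"
      by (subst (asm) AE_restrict_space_iff) auto
  qed
qed (simp add: set_integrable_def)



section \<open>Control problems linear in the state\<close>

text \<open>One admissible control is fixed, so that the derivatives along it become functions of time alone.
  These are \<open>fx\<close> and \<open>f0x\<close>, the matrix and the row vector of partial derivatives in \<open>x\<close>; evaluating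
  them at the state 0 is an arbitrary choice.\<close>

locale linear_control_problem = control_problem f f0 l U C
  for f :: "real^'m \<Rightarrow> 'u::euclidean_space \<Rightarrow> real \<Rightarrow> real^'m"
    and f0 :: "real^'m \<Rightarrow> 'u \<Rightarrow> real \<Rightarrow> real"
    and l :: "real^'m \<Rightarrow> real"
    and U :: "real \<Rightarrow> 'u set"
    and C :: "(real^'m) set" +
  fixes u :: "real \<Rightarrow> 'u"
  assumes linear_f: "linear_in_state f" and linear_f0: "linear_in_state f0"
    and admissible: "u \<in> admissible_controls U"
begin

definition fx :: "real \<Rightarrow> real^'m^'m" where "fx t = vector_field_dx f 0 (u t) t"
definition f0x :: "real \<Rightarrow> real^'m" where "f0x t = integrand_dx f0 0 (u t) t"

lemma vector_field_affine:
  assumes "t \<ge> 0"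
  shows "vector_field_dx f x v t = matrix (\<lambda>h. f h v t - f 0 v t)"
    and "f x v t = f 0 v t + vector_field_dx f y v t *v x"
proof -
  have lin: "linear (\<lambda>h. f h v t - f 0 v t)" using linear_f assms by (simp add: linear_in_state_def)
  have "((\<lambda>y. (f y v t - f 0 v t) + f 0 v t) has_derivative (\<lambda>h. (f h v t - f 0 v t) + 0)) (at x)" for x
    by (intro has_derivative_add has_derivative_const linear_imp_has_derivative lin)
  then have "frechet_derivative (\<lambda>y. f y v t) (at x) = (\<lambda>h. f h v t - f 0 v t)" for x
    using frechet_derivative_at[of "\<lambda>y. f y v t" "\<lambda>h. f h v t - f 0 v t" x] by simp
  then show *: "vector_field_dx f x v t = matrix (\<lambda>h. f h v t - f 0 v t)" for x
    by (simp add: vector_field_dx_def jacobian_def)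
  show "f x v t = f 0 v t + vector_field_dx f y v t *v x"
    unfolding * using fun_cong[OF matrix_vector_mul(2)[OF lin], of x] by simp
qed

lemma integrand_affine:
  assumes "t \<ge> 0"
  shows "integrand_dx f0 x v t = integrand_dx f0 0 v t"
    and "f0 x v t = f0 0 v t + inner (integrand_dx f0 0 v t) x"
proof -
  have lin: "linear (\<lambda>h. f0 h v t - f0 0 v t)" using linear_f0 assms by (simp add: linear_in_state_def)
  define w where "w = adjoint (\<lambda>h. f0 h v t - f0 0 v t) 1"
  have w: "f0 h v t = f0 0 v t + inner h w" for h
    using adjoint_works[OF lin, of h 1] by (simp add: w_def)
  have "GDERIV (\<lambda>y. f0 y v t) x :> w" for x
    unfolding gderiv_def by (subst w) (auto intro!: derivative_eq_intros)
  then have *: "integrand_dx f0 x v t = w" for x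
    unfolding integrand_dx_def by (rule gradient_eqI)
  show "integrand_dx f0 x v t = integrand_dx f0 0 v t" by (simp add: *)
  show "f0 x v t = f0 0 v t + inner (integrand_dx f0 0 v t) x"
    using w[of x] by (simp add: * inner_commute)
qed

lemma f_along: "t \<ge> 0 \<Longrightarrow> f x (u t) t = f 0 (u t) t + fx t *v x"
  unfolding fx_def by (rule vector_field_affine(2))

lemma vector_field_dx_along: "t \<ge> 0 \<Longrightarrow> vector_field_dx f x (u t) t = fx t"
  by (simp add: fx_def vector_field_affine(1))

lemma f0_along: "t \<ge> 0 \<Longrightarrow> f0 x (u t) t = f0 0 (u t) t + inner (f0x t) x"
  unfolding f0x_def by (rule integrand_affine(2))

lemma integrand_dx_along: "t \<ge> 0 \<Longrightarrow> integrand_dx f0 x (u t) t = f0x t"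
  unfolding f0x_def by (rule integrand_affine(1))

lemma hamiltonian_gradient:
  assumes "t \<ge> 0"
  shows "gradient (\<lambda>y. hamiltonian f f0 y (u t) p lam t) x = p v* fx t - lam *\<^sub>R f0x t"
proof (rule gradient_eqI)
  have "hamiltonian f f0 y (u t) p lam t = inner p (f 0 (u t) t) - lam * f0 0 (u t) t + inner y (p v* fx t - lam *\<^sub>R f0x t)" for y
    by (simp add: hamiltonian_def f_along[OF assms, of y] f0_along[OF assms, of y] inner_diff_right
        inner_add_right inner_commute[of y] dot_lmul_matrix algebra_simps)
  then show "GDERIV (\<lambda>y. hamiltonian f f0 y (u t) p lam t) x :> p v* fx t - lam *\<^sub>R f0x t"
    unfolding gderiv_def by (auto intro!: derivative_eq_intros)
qed

lemma fx_integrable: "fx absolutely_integrable_on {0..T}"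
  unfolding fx_def[abs_def]
  by (rule integrable_along_control[OF f_dx_bounds admissible f_dx_caratheodory[OF admissible]])

lemma f0x_integrable: "f0x absolutely_integrable_on {0..T}"
  unfolding f0x_def[abs_def]
  by (rule integrable_along_control[OF f0_dx_bounds admissible f0_dx_caratheodory[OF admissible]])

lemma f0_integrable: "(\<lambda>t. f0 0 (u t) t) absolutely_integrable_on {0..T}"
  by (rule integrable_along_control[OF f0_bounds admissible f0_caratheodory[OF admissible]])

lemma variation_matrix_solution:
  shows "ode_solution (\<lambda>t A. fx t ** A) (variation_matrix f u \<xi>)" and "variation_matrix f u \<xi> 0 = mat 1"
proof -
  have "\<exists>A. ode_solution (\<lambda>t A. fx t ** A) A \<and> A 0 = mat 1"
    by (rule linear_ode_exists[OF bounded_bilinear_matrix_matrix_mult fx_integrable])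
  moreover have "variation_matrix f u \<xi> = (SOME A. ode_solution (\<lambda>t A. fx t ** A) A \<and> A 0 = mat 1)"
    unfolding variation_matrix_def
    by (subst ode_solution_cong[of "\<lambda>t B. vector_field_dx f (trajectory f \<xi> u t) (u t) t ** B" "\<lambda>t A. fx t ** A"])
      (auto simp: vector_field_dx_along)
  ultimately show "ode_solution (\<lambda>t A. fx t ** A) (variation_matrix f u \<xi>)" "variation_matrix f u \<xi> 0 = mat 1"
    using someI_ex by (metis (mono_tags, lifting))+
qed

text \<open>The solution of \<open>dB/dt = - B (\<partial>f/\<partial>x)\<close> makes \<open>B A\<close> constant. It serves to invert \<open>A\<close> and, in the next lemma, to
  prove uniqueness without Gronwall's inequality.\<close>

lemma inverse_matrix_solution:
  obtains B where "ode_solution (\<lambda>t B. - (B ** fx t)) B" "B 0 = mat 1"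
    "\<And>\<xi> t. t \<ge> 0 \<Longrightarrow> B t ** variation_matrix f u \<xi> t = mat 1"
    "\<And>\<xi> t. t \<ge> 0 \<Longrightarrow> variation_matrix f u \<xi> t ** B t = mat 1"
proof -
  have "bounded_bilinear (\<lambda>(X :: real^'m^'m) Y. - (Y ** X))"
    using bounded_bilinear.flip[OF bounded_bilinear.comp[OF bounded_bilinear_matrix_matrix_mult
        bounded_linear_minus[OF bounded_linear_ident] bounded_linear_ident]]
    by (simp add: bounded_bilinear.minus_left[OF bounded_bilinear_matrix_matrix_mult])
  then obtain B where B: "ode_solution (\<lambda>t B. - (B ** fx t)) B" "B 0 = mat 1"
    using linear_ode_exists[OF _ fx_integrable, of "\<lambda>X Y. - (Y ** X)" "mat 1"] by blast
  have BA: "B T ** variation_matrix f u \<xi> T = mat 1" if "T \<ge> 0" for T \<xi>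
  proof -
    let ?A = "variation_matrix f u \<xi>"
    have "((\<lambda>t. B t ** (fx t ** ?A t) + - (B t ** fx t) ** ?A t) has_integral
        (B T ** ?A T - B 0 ** ?A 0)) {0..T}"
      by (rule has_integral_ode_product[OF bounded_bilinear_matrix_matrix_mult B(1) variation_matrix_solution(1) that])
    moreover have "B t ** (fx t ** ?A t) + - (B t ** fx t) ** ?A t = 0" for t
      using bounded_bilinear.minus_left[OF bounded_bilinear_matrix_matrix_mult, of "B t ** fx t" "?A t"]
      by (simp add: matrix_mul_assoc)
    ultimately have "((\<lambda>t. 0) has_integral (B T ** ?A T - B 0 ** ?A 0)) {0..T}"
      by simp
    then have "B T ** ?A T - B 0 ** ?A 0 = 0"
      using has_integral_0 has_integral_unique by blast
    then show ?thesis by (simp add: B variation_matrix_solution)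
  qed
  show thesis
    using that[OF B BA] BA matrix_left_right_inverse by blast
qed

text \<open>The product \<open>B z\<close> is constant, and \<open>B\<close> is the inverse of \<open>A\<close>.\<close>

lemma homogeneous_solution:
  assumes z: "ode_solution (\<lambda>t y. fx t *v y) z" and "T \<ge> 0"
  shows "z T = variation_matrix f u \<xi> T *v z 0"
proof -
  obtain B where B: "ode_solution (\<lambda>t B. - (B ** fx t)) B" "B 0 = mat 1"
    "\<And>\<xi> t. t \<ge> 0 \<Longrightarrow> variation_matrix f u \<xi> t ** B t = mat 1"
    using inverse_matrix_solution by metis
  have "((\<lambda>t. B t *v (fx t *v z t) + - (B t ** fx t) *v z t) has_integral
      (B T *v z T - B 0 *v z 0)) {0..T}"
    by (rule has_integral_ode_product[OF bounded_bilinear_matrix_vector_mult B(1) z \<open>T \<ge> 0\<close>])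
  moreover have "B t *v (fx t *v z t) + - (B t ** fx t) *v z t = 0" for t
    using bounded_bilinear.minus_left[OF bounded_bilinear_matrix_vector_mult, of "B t ** fx t" "z t"]
    by (simp add: matrix_vector_mul_assoc)
  ultimately have "((\<lambda>t. 0) has_integral (B T *v z T - B 0 *v z 0)) {0..T}"
    by simp
  then have "B T *v z T = z 0"
    using has_integral_0 has_integral_unique B(2) by fastforce
  then have "variation_matrix f u \<xi> T *v z 0 = (variation_matrix f u \<xi> T ** B T) *v z T"
    by (simp add: matrix_vector_mul_assoc flip: matrix_vector_mul_assoc)
  then show ?thesis using B(3) \<open>T \<ge> 0\<close> by simp
qed

text \<open>One solution is enough: adding solutions \<open>A c\<close> of the homogeneous equation produces solutions for all other
  initial points.\<close>

lemma trajectory_solution: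
  assumes x: "ode_solution (\<lambda>t y. f y (u t) t) x"
  shows "ode_solution (\<lambda>t y. f y (u t) t) (trajectory f b u)" and "trajectory f b u 0 = b"
proof -
  let ?A = "variation_matrix f u b"
  define y where "y t = x t + ?A t *v (b - x 0)" for t
  obtain N where N: "negligible N"
    "\<And>t. t \<ge> 0 \<Longrightarrow> t \<notin> N \<Longrightarrow> (x has_vector_derivative f (x t) (u t) t) (at t within {0..})"
    using ode_solutionE[OF x] by blast
  obtain N' where N': "negligible N'"
    "\<And>t. t \<ge> 0 \<Longrightarrow> t \<notin> N' \<Longrightarrow> (?A has_vector_derivative fx t ** ?A t) (at t within {0..})"
    using ode_solutionE[OF variation_matrix_solution(1)] by blast
  have bl: "bounded_linear (\<lambda>X :: real^'m^'m. X *v (b - x 0))"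
    by (rule bounded_bilinear.bounded_linear_left[OF bounded_bilinear_matrix_vector_mult])
  have "ode_solution (\<lambda>t y. f y (u t) t) y"
    unfolding ode_solution_iff
  proof (intro conjI allI impI exI[of _ "N \<union> N'"])
    show "absolutely_continuous_on {0..T} y" for T
      unfolding y_def
      by (intro absolutely_continuous_on_add absolutely_continuous_on_bounded_linear[OF bl]
          ode_solution_absolutely_continuous[OF x] ode_solution_absolutely_continuous[OF variation_matrix_solution(1)])
    show "negligible (N \<union> N')" using N N' by simp
    show "(y has_vector_derivative f (y t) (u t) t) (at t within {0..})" if t: "t \<ge> 0" "t \<notin> N \<union> N'" for t
    proof -
      have "(y has_vector_derivative f (x t) (u t) t + (fx t ** ?A t) *v (b - x 0)) (at t within {0..})"
        unfolding y_def[abs_def] using t N(2)[of t] N'(2)[of t]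
        by (intro has_vector_derivative_add bounded_linear.has_vector_derivative[OF bl]) auto
      moreover have "f (x t) (u t) t + (fx t ** ?A t) *v (b - x 0) = f (y t) (u t) t"
        using f_along[OF t(1), of "x t"] f_along[OF t(1), of "y t"]
        by (simp add: y_def matrix_vector_right_distrib matrix_vector_mul_assoc)
      ultimately show ?thesis by simp
    qed
  qed
  moreover have "y 0 = b" by (simp add: y_def variation_matrix_solution)
  ultimately have "\<exists>y. ode_solution (\<lambda>t y. f y (u t) t) y \<and> y 0 = b" by blast
  then show "ode_solution (\<lambda>t y. f y (u t) t) (trajectory f b u)" "trajectory f b u 0 = b"
    unfolding trajectory_def using someI_ex by (metis (mono_tags, lifting))+
qed

lemma trajectory_shift:
  assumes x: "ode_solution (\<lambda>t y. f y (u t) t) x" and "T \<ge> 0"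
  shows "trajectory f b u T = trajectory f c u T + variation_matrix f u \<xi> T *v (b - c)"
proof -
  note sol = trajectory_solution[OF x]
  define z where "z t = trajectory f b u t - trajectory f c u t" for t
  obtain N where N: "negligible N"
    "\<And>t. t \<ge> 0 \<Longrightarrow> t \<notin> N \<Longrightarrow>
        (trajectory f b u has_vector_derivative f (trajectory f b u t) (u t) t) (at t within {0..})"
    using ode_solutionE[OF sol(1)] by blast
  obtain N' where N': "negligible N'"
    "\<And>t. t \<ge> 0 \<Longrightarrow> t \<notin> N' \<Longrightarrow>
        (trajectory f c u has_vector_derivative f (trajectory f c u t) (u t) t) (at t within {0..})"
    using ode_solutionE[OF sol(1)] by blast
  have "ode_solution (\<lambda>t y. fx t *v y) z"
    unfolding ode_solution_iff
  proof (intro conjI allI impI exI[of _ "N \<union> N'"])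
    show "absolutely_continuous_on {0..T} z" for T
      unfolding z_def by (intro absolutely_continuous_on_diff ode_solution_absolutely_continuous[OF sol(1)])
    show "negligible (N \<union> N')" using N N' by simp
    show "(z has_vector_derivative fx t *v z t) (at t within {0..})" if t: "t \<ge> 0" "t \<notin> N \<union> N'" for t
    proof -
      have "(z has_vector_derivative f (trajectory f b u t) (u t) t - f (trajectory f c u t) (u t) t) (at t within {0..})"
        unfolding z_def[abs_def] using t N(2)[of t] N'(2)[of t]
        by (intro has_vector_derivative_diff) auto
      moreover have "f (trajectory f b u t) (u t) t - f (trajectory f c u t) (u t) t = fx t *v z t"
        using f_along[OF t(1), of "trajectory f b u t"] f_along[OF t(1), of "trajectory f c u t"]
        by (simp add: z_def matrix_vector_mult_diff_distrib)
      ultimately show ?thesis by simp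
    qed
  qed
  from homogeneous_solution[OF this \<open>T \<ge> 0\<close>, of \<xi>] show ?thesis
    by (simp add: z_def sol algebra_simps)
qed

lemma variation_integrand_integrable:
  "(\<lambda>t. f0x t v* variation_matrix f u \<xi> t) absolutely_integrable_on {0..T}"
  by (intro absolutely_integrable_bilinear_continuous[OF bounded_bilinear_vector_matrix_mult f0x_integrable]
      absolutely_continuous_on_imp_continuous ode_solution_absolutely_continuous[OF variation_matrix_solution(1)])

lemma variation_integral_has_integral:
  "((\<lambda>t. f0x t v* variation_matrix f u \<xi> t) has_integral variation_integral f f0 u \<xi> T) {0..T}"
proof -
  have "variation_integral f f0 u \<xi> T = (LINT t:{0..T}|lebesgue. f0x t v* variation_matrix f u \<xi> t)"
    unfolding variation_integral_def
    by (rule set_lebesgue_integral_cong) (auto simp: integrand_dx_along)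
  then show ?thesis
    using has_integral_set_lebesgue[OF variation_integrand_integrable] by simp
qed

text \<open>In the derivative of \<open>\<psi> A\<close> the terms with \<open>\<partial>f/\<partial>x\<close> cancel, which leaves \<open>\<lambda>\<close> times the integrand of \<open>I\<close>.\<close>

lemma adjoint_formula:
  assumes \<psi>: "adjoint_solution f f0 x u \<psi> lam" and "T \<ge> 0"
  shows "\<psi> T v* variation_matrix f u \<xi> T = \<psi> 0 + lam *\<^sub>R variation_integral f f0 u \<xi> T"
proof -
  let ?A = "variation_matrix f u \<xi>"
  have ode: "ode_solution (\<lambda>t p. lam *\<^sub>R f0x t - p v* fx t) \<psi>"
    using \<psi> unfolding adjoint_solution_def
    by (subst (asm) ode_solution_cong[where rhs' = "\<lambda>t p. lam *\<^sub>R f0x t - p v* fx t"]) (auto simp: hamiltonian_gradient)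
  have "((\<lambda>t. \<psi> t v* (fx t ** ?A t) + (lam *\<^sub>R f0x t - \<psi> t v* fx t) v* ?A t) has_integral
      (\<psi> T v* ?A T - \<psi> 0 v* ?A 0)) {0..T}"
    by (rule has_integral_ode_product[OF bounded_bilinear_vector_matrix_mult ode variation_matrix_solution(1) \<open>T \<ge> 0\<close>])
  moreover have "\<psi> t v* (fx t ** ?A t) + (lam *\<^sub>R f0x t - \<psi> t v* fx t) v* ?A t = lam *\<^sub>R (f0x t v* ?A t)" for t
    by (simp add: vector_matrix_mult_diff_distrib vector_matrix_mul_assoc scaleR_vector_matrix_assoc)
  ultimately have "((\<lambda>t. lam *\<^sub>R (f0x t v* ?A t)) has_integral (\<psi> T v* ?A T - \<psi> 0 v* ?A 0)) {0..T}"
    by simp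
  then have "\<psi> T v* ?A T - \<psi> 0 v* ?A 0 = lam *\<^sub>R variation_integral f f0 u \<xi> T"
    using has_integral_unique has_integral_scaleR_left has_integral_cmul[OF variation_integral_has_integral] by blast
  then show ?thesis by (simp add: variation_matrix_solution algebra_simps)
qed

text \<open>Trajectories are affine in the initial point with slope \<open>A\<close>, and the integrand is affine in the state.\<close>

lemma cost_affine:
  assumes x: "ode_solution (\<lambda>t y. f y (u t) t) x" and "T \<ge> 0"
  shows "cost f f0 b u T = cost f f0 c u T + inner (variation_integral f f0 u \<xi> T) (b - c)"
proof -
  note sol = trajectory_solution[OF x]
  have cint: "((\<lambda>t. f0 0 (u t) t + inner (f0x t) (trajectory f b u t)) has_integral cost f f0 b u T) {0..T}" for b
  proof -
    have "(\<lambda>t. inner (f0x t) (trajectory f b u t)) absolutely_integrable_on {0..T}"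
      by (intro absolutely_integrable_bilinear_continuous[OF bounded_bilinear_inner f0x_integrable]
          absolutely_continuous_on_imp_continuous ode_solution_absolutely_continuous[OF sol(1)])
    then have "(\<lambda>t. f0 0 (u t) t + inner (f0x t) (trajectory f b u t)) absolutely_integrable_on {0..T}"
      using f0_integrable by (intro set_integral_add)
    moreover have "cost f f0 b u T = (LINT t:{0..T}|lebesgue. f0 0 (u t) t + inner (f0x t) (trajectory f b u t))"
      unfolding cost_def by (rule set_lebesgue_integral_cong) (auto simp: f0_along[symmetric])
    ultimately show ?thesis using has_integral_set_lebesgue by simp
  qed
  have "((\<lambda>t. inner (f0x t v* variation_matrix f u \<xi> t) (b - c)) has_integral
      inner (variation_integral f f0 u \<xi> T) (b - c)) {0..T}"
    using has_integral_linear[OF variation_integral_has_integral bounded_linear_inner_left[of "b - c"]]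
    by (simp add: o_def)
  from has_integral_add[OF cint[of c] this]
  have "((\<lambda>t. f0 0 (u t) t + inner (f0x t) (trajectory f b u t)) has_integral
      cost f f0 c u T + inner (variation_integral f f0 u \<xi> T) (b - c)) {0..T}"
  proof (rule has_integral_eq[rotated])
    fix t
    assume "t \<in> {0..T}"
    then have "trajectory f b u t = trajectory f c u t + variation_matrix f u \<xi> t *v (b - c)"
      using trajectory_shift[OF x] by simp
    then show "f0 0 (u t) t + inner (f0x t) (trajectory f c u t) + inner (f0x t v* variation_matrix f u \<xi> t) (b - c)
        = f0 0 (u t) t + inner (f0x t) (trajectory f b u t)"
      by (simp add: dot_lmul_matrix inner_add_right)
  qed
  then show ?thesis using cint has_integral_unique by blast
qed

end


section \<open>Stationarity at a minimum over a closed set\<close>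

lemma limiting_normal_coneI:
  "b \<in> C \<Longrightarrow> q \<in> proximal_normal_cone C b \<Longrightarrow> q \<in> limiting_normal_cone C b"
  unfolding limiting_normal_cone_def mem_Collect_eq
  by (rule exI[of _ "\<lambda>_. b"], rule exI[of _ "\<lambda>_. q"]) auto

text \<open>Squares of distances are quadratic, so they can be moved into the proximal error term up to their
  gradients at the minimizer.\<close>

lemma proximal_subgradient_of_penalty_minimum:
  fixes l :: "'a::real_inner \<Rightarrow> real"
  assumes "k \<ge> 0" and min: "\<forall>\<^sub>F x in nhds z.
      l z + inner v z + k * (norm (z - y))\<^sup>2 + (norm (z - b))\<^sup>2
        \<le> l x + inner v x + k * (norm (x - y))\<^sup>2 + (norm (x - b))\<^sup>2"
  shows "- (v + (2 * k) *\<^sub>R (z - y) + 2 *\<^sub>R (z - b)) \<in> proximal_subdifferential l z"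
proof -
  have sq: "(norm (x - w))\<^sup>2 = (norm (z - w))\<^sup>2 + 2 * inner (z - w) (x - z) + (norm (x - z))\<^sup>2" for x w :: 'a
    unfolding power2_norm_eq_inner by (simp add: inner_diff_left inner_diff_right inner_commute)
  have "\<forall>\<^sub>F x in nhds z. l x \<ge> l z + inner (- (v + (2 * k) *\<^sub>R (z - y) + 2 *\<^sub>R (z - b))) (x - z) - (k + 1) * (norm (x - z))\<^sup>2"
    using min
  proof eventually_elim
    case (elim x)
    have "l z + inner v z + k * (norm (z - y))\<^sup>2 + (norm (z - b))\<^sup>2 \<le> l x + inner v x
        + k * ((norm (z - y))\<^sup>2 + 2 * inner (z - y) (x - z) + (norm (x - z))\<^sup>2)
        + ((norm (z - b))\<^sup>2 + 2 * inner (z - b) (x - z) + (norm (x - z))\<^sup>2)"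
      using elim by (simp only: sq[of x y] sq[of x b])
    moreover have "inner v x = inner v z + inner v (x - z)"
      by (simp add: inner_diff_right)
    moreover have "inner (- (v + (2 * k) *\<^sub>R (z - y) + 2 *\<^sub>R (z - b))) (x - z)
        = - inner v (x - z) - 2 * (k * inner (z - y) (x - z)) - 2 * inner (z - b) (x - z)"
      by (simp only: inner_add_left inner_minus_left inner_scaleR_left)
    ultimately show ?case
      by (simp add: distrib_left distrib_right)
  qed
  then show ?thesis
    unfolding proximal_subdifferential_def using \<open>k \<ge> 0\<close> by (auto intro!: exI[of _ "k + 1"])
qed

text \<open>Points of \<open>C\<close> at distance at least \<open>d\<close> satisfy the proximal inequality for any sufficiently large constant,
  because there the square of the distance dominates \<open>d\<close> times the distance.\<close>

lemma proximal_normal_of_local_projection: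
  fixes C :: "'a::real_inner set"
  assumes "k \<ge> 0" "d > 0"
    and min: "\<And>\<eta>. \<eta> \<in> C \<Longrightarrow> norm (\<eta> - y) < d \<Longrightarrow> k * (norm (z - y))\<^sup>2 \<le> k * (norm (z - \<eta>))\<^sup>2"
  shows "(2 * k) *\<^sub>R (z - y) \<in> proximal_normal_cone C y"
proof -
  define q where "q = (2 * k) *\<^sub>R (z - y)"
  have "inner q (\<eta> - y) \<le> (k + norm q / d) * (norm (\<eta> - y))\<^sup>2" if "\<eta> \<in> C" for \<eta>
  proof (cases "norm (\<eta> - y) < d")
    case True
    have "(norm (z - \<eta>))\<^sup>2 = (norm (z - y))\<^sup>2 - 2 * inner (z - y) (\<eta> - y) + (norm (\<eta> - y))\<^sup>2"
      unfolding power2_norm_eq_inner by (simp add: inner_diff_left inner_diff_right inner_commute)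
    then have "k * (norm (z - y))\<^sup>2 \<le> k * ((norm (z - y))\<^sup>2 - 2 * inner (z - y) (\<eta> - y) + (norm (\<eta> - y))\<^sup>2)"
      using min[OF that True] by simp
    then have "inner q (\<eta> - y) \<le> k * (norm (\<eta> - y))\<^sup>2"
      by (simp add: q_def algebra_simps)
    also have "\<dots> \<le> (k + norm q / d) * (norm (\<eta> - y))\<^sup>2"
      using \<open>d > 0\<close> by (intro mult_right_mono) auto
    finally show ?thesis .
  next
    case False
    have "inner q (\<eta> - y) \<le> norm q * norm (\<eta> - y)" by (rule norm_cauchy_schwarz)
    also have "\<dots> \<le> norm q * (norm (\<eta> - y) * (norm (\<eta> - y) / d))"
      using False \<open>d > 0\<close> mult_right_mono[of d "norm (\<eta> - y)" "norm (\<eta> - y)"]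
      by (intro mult_left_mono) (auto simp: field_simps)
    also have "\<dots> = norm q / d * (norm (\<eta> - y))\<^sup>2"
      by (simp add: power2_eq_square)
    also have "\<dots> \<le> (k + norm q / d) * (norm (\<eta> - y))\<^sup>2"
      using \<open>k \<ge> 0\<close> by (intro mult_right_mono) auto
    finally show ?thesis .
  qed
  then show ?thesis
    unfolding proximal_normal_cone_def q_def[symmetric] using \<open>k \<ge> 0\<close> \<open>d > 0\<close>
    by (auto intro!: exI[of _ "k + norm q / d"])
qed

text \<open>The sum rule for a locally Lipschitz function and the indicator of a closed set. Decouple the two
  by minimizing \<open>l x + v x + k (norm (x - y))\<^sup>2 + (norm (x - b))\<^sup>2\<close> over \<open>x\<close> near \<open>b\<close> and \<open>y\<close> in \<open>C\<close> near \<open>b\<close>. The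
  last term forces the minimizers to converge to \<open>b\<close>. Minimality in \<open>x\<close> gives a proximal subgradient, minimality
  in \<open>y\<close> a proximal normal \<open>q = 2 k (x - y)\<close>, and their sum tends to \<open>- v\<close>. The Lipschitz condition enters in the
  bound of \<open>q\<close> uniformly in \<open>k\<close>, which provides a convergent subsequence.\<close>

lemma minimum_stationary:
  fixes l :: "'a::euclidean_space \<Rightarrow> real"
  assumes C: "closed C" and b: "b \<in> C" and L: "L-lipschitz_on (cball b r) l" and "r > 0"
    and min: "\<And>x. x \<in> C \<Longrightarrow> l b + inner v b \<le> l x + inner v x"
  shows "- v \<in> {p + q |p q. p \<in> limiting_subdifferential l b \<and> q \<in> limiting_normal_cone C b}"
proof -
  define P where "P k = (\<lambda>(x, y). l x + inner v x + real k * (norm (x - y))\<^sup>2 + (norm (x - b))\<^sup>2)" for k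
  define K where "K = cball b r \<times> (C \<inter> cball b r)"
  have K: "compact K" "K \<noteq> {}" "(b, b) \<in> K"
    unfolding K_def using C b \<open>r > 0\<close> by (auto intro!: compact_Times closed_Int_compact)
  have lc: "continuous_on (cball b r) l" using L by (rule lipschitz_on_continuous_on)
  have lcK: "continuous_on K (\<lambda>p. l (fst p))"
    by (rule continuous_on_compose2[OF lc]) (auto simp: K_def intro!: continuous_intros)
  have "continuous_on K (P k)" for k
    unfolding P_def case_prod_unfold by (intro continuous_intros lcK)
  then have "\<exists>p\<in>K. \<forall>p'\<in>K. P k p \<le> P k p'" for k
    using continuous_attains_inf[OF K(1,2)] by blast
  then obtain w where w: "\<And>k. w k \<in> K" "\<And>k p. p \<in> K \<Longrightarrow> P k (w k) \<le> P k p" by metis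
  define x y where "x k = fst (w k)" and "y k = snd (w k)" for k
  have xy: "x k \<in> cball b r" "y k \<in> C" "y k \<in> cball b r" for k
    using w(1)[of k] by (auto simp: K_def x_def y_def)
  have val: "l (x k) + inner v (x k) + real k * (norm (x k - y k))\<^sup>2 + (norm (x k - b))\<^sup>2 \<le> l b + inner v b" for k
    using w(2)[OF K(3), of k] by (simp add: P_def x_def y_def case_prod_unfold)
  have L0: "L \<ge> 0" using L lipschitz_on_nonneg by blast
  define M where "M = L + norm v"
  \<comment> \<open>The penalized minimum is at most \<open>l b + v b\<close>, hence at most \<open>l y + v y\<close> because \<open>y\<close> lies in \<open>C\<close>. The
    Lipschitz constant \<open>M\<close> of \<open>l + v\<close> turns this into \<open>k (norm (x - y))\<^sup>2 \<le> M (norm (x - y))\<close>.\<close>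
  have lip: "l z + inner v z \<le> l x' + inner v x' + M * norm (x' - z)" if "z \<in> cball b r" "x' \<in> cball b r" for z x'
  proof -
    have "l z - l x' \<le> L * norm (x' - z)"
      using lipschitz_onD[OF L that] by (simp add: dist_norm norm_minus_commute abs_le_iff)
    moreover have "inner v (z - x') \<le> norm v * norm (x' - z)"
      using norm_cauchy_schwarz[of v "z - x'"] by (simp add: norm_minus_commute)
    ultimately show ?thesis by (simp add: M_def inner_diff_right algebra_simps)
  qed
  have est: "real k * (norm (x k - y k))\<^sup>2 + (norm (x k - b))\<^sup>2 \<le> M * norm (x k - y k)" for k
    using val[of k] min[OF xy(2)[of k]] lip[OF xy(3) xy(1), of k k] by simp
  have M0: "M \<ge> 0" using L0 by (simp add: M_def)
  have gap: "real k * norm (x k - y k) \<le> M" for k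
  proof (cases "norm (x k - y k) = 0")
    case False
    have "real k * norm (x k - y k) * norm (x k - y k) \<le> M * norm (x k - y k)"
      using est[of k] by (simp add: power2_eq_square mult.assoc) (smt (verit) zero_le_square)
    then show ?thesis using False by simp
  qed (use M0 in simp)
  have "(\<lambda>k. norm (x k - y k)) \<longlonglongrightarrow> 0"
  proof (rule tendsto_sandwich[OF _ _ tendsto_const])
    show "\<forall>\<^sub>F k in sequentially. norm (x k - y k) \<le> M / real k"
      using eventually_gt_at_top[of 0]
    proof eventually_elim
      case (elim k)
      then show ?case using gap[of k] by (simp add: field_simps)
    qed
    show "(\<lambda>k. M / real k) \<longlonglongrightarrow> 0" by (rule lim_const_over_n)
  qed simp
  then have xy0: "(\<lambda>k. x k - y k) \<longlonglongrightarrow> 0" by (rule tendsto_norm_zero_cancel)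
  have "(\<lambda>k. (norm (x k - b))\<^sup>2) \<longlonglongrightarrow> 0"
  proof (rule tendsto_sandwich[OF _ _ tendsto_const])
    have "(norm (x k - b))\<^sup>2 \<le> M * norm (x k - y k)" for k
      using est[of k] by (smt (verit) of_nat_0_le_iff zero_le_power2 mult_nonneg_nonneg)
    then show "\<forall>\<^sub>F k in sequentially. (norm (x k - b))\<^sup>2 \<le> M * norm (x k - y k)" by simp
    show "(\<lambda>k. M * norm (x k - y k)) \<longlonglongrightarrow> 0"
      using \<open>(\<lambda>k. norm (x k - y k)) \<longlonglongrightarrow> 0\<close> by (rule tendsto_mult_right_zero)
  qed simp
  then have "(\<lambda>k. sqrt ((norm (x k - b))\<^sup>2)) \<longlonglongrightarrow> sqrt 0" by (rule tendsto_real_sqrt)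
  then have "(\<lambda>k. norm (x k - b)) \<longlonglongrightarrow> 0" by simp
  then have xb0: "(\<lambda>k. x k - b) \<longlonglongrightarrow> 0" by (rule tendsto_norm_zero_cancel)
  then have xb: "x \<longlonglongrightarrow> b" by (simp add: LIM_zero_iff)
  have yb: "y \<longlonglongrightarrow> b" using tendsto_diff[OF xb xy0] by simp
  have "\<forall>\<^sub>F k in sequentially. norm (x k - b) < r \<and> norm (y k - b) < r"
    using tendstoD[OF xb \<open>r > 0\<close>] tendstoD[OF yb \<open>r > 0\<close>] by eventually_elim (simp add: dist_norm)
  then obtain k0 where k0: "\<And>k. k \<ge> k0 \<Longrightarrow> norm (x k - b) < r \<and> norm (y k - b) < r"
    by (auto simp: eventually_sequentially)
  define q where "q k = (2 * real k) *\<^sub>R (x k - y k)" for k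
  define p where "p k = - (v + q k + 2 *\<^sub>R (x k - b))" for k
  have p: "p k \<in> proximal_subdifferential l (x k)" if "k \<ge> k0" for k
    unfolding p_def q_def
  proof (rule proximal_subgradient_of_penalty_minimum)
    have "\<forall>\<^sub>F z in nhds (x k). z \<in> ball b r"
      using k0[OF that] by (intro eventually_nhds_in_open) (auto simp: dist_norm norm_minus_commute)
    then show "\<forall>\<^sub>F z in nhds (x k). l (x k) + inner v (x k) + real k * (norm (x k - y k))\<^sup>2 + (norm (x k - b))\<^sup>2
        \<le> l z + inner v z + real k * (norm (z - y k))\<^sup>2 + (norm (z - b))\<^sup>2"
    proof eventually_elim
      case (elim z)
      then have "(z, y k) \<in> K" using xy by (auto simp: K_def)
      from w(2)[OF this, of k] show ?case by (simp add: P_def x_def y_def case_prod_unfold)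
    qed
  qed simp
  have q: "q k \<in> proximal_normal_cone C (y k)" if "k \<ge> k0" for k
    unfolding q_def
  proof (rule proximal_normal_of_local_projection)
    show "r - norm (y k - b) > 0" using k0[OF that] by simp
    fix \<eta>
    assume "\<eta> \<in> C" "norm (\<eta> - y k) < r - norm (y k - b)"
    then have "(x k, \<eta>) \<in> K"
      using xy(1)[of k] norm_triangle_ineq[of "\<eta> - y k" "y k - b"]
      by (auto simp: K_def dist_norm norm_minus_commute)
    from w(2)[OF this, of k] show "real k * (norm (x k - y k))\<^sup>2 \<le> real k * (norm (x k - \<eta>))\<^sup>2"
      by (simp add: P_def x_def y_def case_prod_unfold)
  qed simp
  have "norm (q k) \<le> 2 * M" for k
    using gap[of k] by (simp add: q_def)
  then have "bounded (range q)" by (auto simp: bounded_iff)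
  then obtain q0 s where s: "strict_mono (s :: nat \<Rightarrow> nat)" "(q \<circ> s) \<longlonglongrightarrow> q0"
    using bounded_imp_convergent_subsequence by blast
  \<comment> \<open>From index \<open>k0\<close> on the minimizers are interior to the balls.\<close>
  define s' where "s' n = s (n + k0)" for n
  have s': "s' n \<ge> k0" for n using seq_suble[OF s(1), of "n + k0"] by (simp add: s'_def)
  have "strict_mono s'" using s(1) by (auto simp: s'_def strict_mono_def)
  have lim: "(\<lambda>n. h (s' n)) \<longlonglongrightarrow> h0" if "h \<longlonglongrightarrow> h0" for h :: "nat \<Rightarrow> 'a" and h0
    using LIMSEQ_subseq_LIMSEQ[OF that \<open>strict_mono s'\<close>] by (simp add: o_def)
  have qlim: "(\<lambda>n. q (s' n)) \<longlonglongrightarrow> q0"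
    using LIMSEQ_ignore_initial_segment[OF s(2), of k0] by (simp add: s'_def o_def)
  have "(\<lambda>n. p (s' n)) \<longlonglongrightarrow> - (v + q0 + 2 *\<^sub>R 0)"
    unfolding p_def by (intro tendsto_intros qlim lim[OF xb0])
  then have plim: "(\<lambda>n. p (s' n)) \<longlonglongrightarrow> - (v + q0)" by simp
  have "q0 \<in> limiting_normal_cone C b"
    unfolding limiting_normal_cone_def mem_Collect_eq
    by (rule exI[of _ "\<lambda>n. y (s' n)"], rule exI[of _ "\<lambda>n. q (s' n)"])
      (use qlim lim[OF yb] q[OF s'] xy(2) in simp)
  moreover have "- (v + q0) \<in> limiting_subdifferential l b"
    unfolding limiting_subdifferential_def mem_Collect_eq
    by (rule exI[of _ "\<lambda>n. x (s' n)"], rule exI[of _ "\<lambda>n. p (s' n)"])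
      (use plim lim[OF xb] p[OF s'] in simp)
  moreover have "- v = - (v + q0) + q0" by simp
  ultimately show ?thesis by blast
qed


section \<open>Optimality and the transversality relation\<close>

context linear_control_problem
begin

text \<open>For multiplier 0 the adjoint formula says that \<open>\<psi> A\<close> is constant.\<close>

lemma adjoint_solution_zero:
  assumes \<psi>: "adjoint_solution f f0 x u \<psi> 0" and "\<psi> 0 = 0" and "T \<ge> 0"
  shows "\<psi> T = 0"
proof -
  obtain B where B: "\<And>\<xi> t. t \<ge> 0 \<Longrightarrow> variation_matrix f u \<xi> t ** B t = mat 1"
    using inverse_matrix_solution by metis
  have "\<psi> T v* variation_matrix f u 0 T = 0"
    using adjoint_formula[OF \<psi> \<open>T \<ge> 0\<close>, of 0] \<open>\<psi> 0 = 0\<close> by simp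
  then have "(\<psi> T v* variation_matrix f u 0 T) v* B T = 0" by simp
  then show ?thesis
    using B[OF \<open>T \<ge> 0\<close>, of 0] by (simp add: vector_matrix_mul_assoc)
qed

text \<open>Competitors with the optimal control and another initial point suffice; their cost is affine in that
  point.\<close>

lemma optimal_imp_almost_minimal:
  assumes opt: "uniformly_overtaking_optimal f f0 l U C \<tau> b' u"
    and x: "ode_solution (\<lambda>t y. f y (u t) t) x" and \<tau>: "\<And>n. \<tau> n \<ge> 0" and "\<delta> > 0"
  shows "\<forall>\<^sub>F n in sequentially. \<forall>b\<in>C.
           l b' - \<delta> \<le> l b + inner (variation_integral f f0 u b' (\<tau> n)) (b - b')"
proof -
  let ?inf = "\<lambda>n. INF (b, u) \<in> C \<times> admissible_controls U. ereal (l b + cost f f0 b u (\<tau> n))"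
  have "ereal (- \<delta>) < liminf (\<lambda>n. ?inf n - ereal (l b' + cost f f0 b' u (\<tau> n)))"
    using opt \<open>\<delta> > 0\<close> unfolding uniformly_overtaking_optimal_def
    by (auto intro: less_le_trans[of _ 0])
  then have "\<forall>\<^sub>F n in sequentially. ereal (- \<delta>) < ?inf n - ereal (l b' + cost f f0 b' u (\<tau> n))"
    by (rule less_LiminfD)
  then show ?thesis
  proof eventually_elim
    case (elim n)
    show ?case
    proof
      fix b
      assume "b \<in> C"
      then have "?inf n \<le> ereal (l b + cost f f0 b u (\<tau> n))"
        using admissible by (intro INF_lower2[of "(b, u)"]) auto
      then have "?inf n - ereal (l b' + cost f f0 b' u (\<tau> n))
          \<le> ereal (l b + cost f f0 b u (\<tau> n)) - ereal (l b' + cost f f0 b' u (\<tau> n))"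
        by (intro ereal_minus_mono) auto
      with elim have "ereal (- \<delta>) < ereal (l b + cost f f0 b u (\<tau> n)) - ereal (l b' + cost f f0 b' u (\<tau> n))"
        by (rule less_le_trans)
      then show "l b' - \<delta> \<le> l b + inner (variation_integral f f0 u b' (\<tau> n)) (b - b')"
        using cost_affine[OF x \<tau>, of b n b' b'] by simp
    qed
  qed
qed

text \<open>The weights \<open>s\<close> treat both alternatives at once: constant weight 1 when the vectors \<open>I\<close> converge, and weights
  \<open>1 / norm I\<close> with limit 0, which suppress \<open>l\<close>, when they are unbounded.\<close>

lemma optimal_limit_minimal:
  assumes opt: "uniformly_overtaking_optimal f f0 l U C \<tau> b' u"
    and x: "ode_solution (\<lambda>t y. f y (u t) t) x" and \<tau>: "\<And>n. \<tau> n \<ge> 0" and r: "strict_mono r"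
    and s: "\<forall>\<^sub>F n in sequentially. s n \<ge> 0" "s \<longlonglongrightarrow> s0"
    and v: "(\<lambda>n. s n *\<^sub>R variation_integral f f0 u b' (\<tau> (r n))) \<longlonglongrightarrow> v" and "b \<in> C"
  shows "s0 * l b' \<le> s0 * l b + inner v (b - b')"
proof (rule field_le_epsilon)
  fix e :: real
  assume "e > 0"
  define \<delta> where "\<delta> = e / (\<bar>s0\<bar> + 1)"
  have \<delta>: "\<delta> > 0" "s0 * \<delta> \<le> e"
  proof -
    show "\<delta> > 0" using \<open>e > 0\<close> by (simp add: \<delta>_def)
    then have "s0 * \<delta> \<le> (\<bar>s0\<bar> + 1) * \<delta>" by (intro mult_right_mono) auto
    also have "\<dots> = e" by (simp add: \<delta>_def)
    finally show "s0 * \<delta> \<le> e" .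
  qed
  have "\<forall>\<^sub>F n in sequentially. l b' - \<delta> \<le> l b + inner (variation_integral f f0 u b' (\<tau> (r n))) (b - b')"
    using eventually_subseq[OF r optimal_imp_almost_minimal[OF opt x \<tau> \<delta>(1)]] \<open>b \<in> C\<close>
    by (auto elim: eventually_mono)
  with s(1) have "\<forall>\<^sub>F n in sequentially.
      s n * (l b' - \<delta>) \<le> s n * l b + inner (s n *\<^sub>R variation_integral f f0 u b' (\<tau> (r n))) (b - b')"
  proof eventually_elim
    case (elim n)
    from mult_left_mono[OF elim(2,1)] show ?case by (simp add: distrib_left)
  qed
  moreover have "(\<lambda>n. s n * (l b' - \<delta>)) \<longlonglongrightarrow> s0 * (l b' - \<delta>)"
    by (intro tendsto_intros s)
  moreover have "(\<lambda>n. s n * l b + inner (s n *\<^sub>R variation_integral f f0 u b' (\<tau> (r n))) (b - b'))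
      \<longlonglongrightarrow> s0 * l b + inner v (b - b')"
    by (intro tendsto_intros s v)
  ultimately have "s0 * (l b' - \<delta>) \<le> s0 * l b + inner v (b - b')"
    by (intro tendsto_le[OF sequentially_bot])
  then show "s0 * l b' \<le> s0 * l b + inner v (b - b') + e"
    using \<delta>(2) by (simp add: right_diff_distrib)
qed

end

theorem corollary3p1:
  fixes f :: "real^'m \<Rightarrow> 'u::euclidean_space \<Rightarrow> real \<Rightarrow> real^'m"
    and f0 :: "real^'m \<Rightarrow> 'u \<Rightarrow> real \<Rightarrow> real"
    and l :: "real^'m \<Rightarrow> real"
    and U :: "real \<Rightarrow> 'u set"
    and C :: "(real^'m) set"
    and \<tau> :: "nat \<Rightarrow> real"
    and b' :: "real^'m"
    and u' :: "real \<Rightarrow> 'u"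
    and \<psi>' :: "real \<Rightarrow> real^'m"
    and lam' :: real
  assumes "control_problem f f0 l U C"
    and "incseq \<tau>" and "filterlim \<tau> at_top sequentially" and "\<And>n. \<tau> n > 0"
    and "uniformly_overtaking_optimal f f0 l U C \<tau> b' u'"
    and "linear_in_state f" and "linear_in_state f0"
    and "limiting_pmp_solution f f0 U \<tau> (trajectory f b' u') u' \<psi>' lam'"
  shows "let I = variation_integral f f0 u' b' in
    \<exists>r c. strict_mono (r :: nat \<Rightarrow> nat) \<and> c > 0 \<and>
    ((convergent (\<lambda>n. I (\<tau> (r n))) \<and>
      c * lam' = 1 \<and>
      c *\<^sub>R \<psi>' 0 = - lim (\<lambda>n. I (\<tau> (r n))) \<and>
      - lim (\<lambda>n. I (\<tau> (r n))) \<in>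
        {p + q |p q. p \<in> limiting_subdifferential l b' \<and> q \<in> limiting_normal_cone C b'})
     \<or>
     (\<not> bounded (range (\<lambda>n. norm (I (\<tau> (r n))))) \<and>
      convergent (\<lambda>n. I (\<tau> (r n)) /\<^sub>R norm (I (\<tau> (r n)))) \<and>
      c * lam' = 0 \<and>
      c *\<^sub>R \<psi>' 0 = - lim (\<lambda>n. I (\<tau> (r n)) /\<^sub>R norm (I (\<tau> (r n)))) \<and>
      - lim (\<lambda>n. I (\<tau> (r n)) /\<^sub>R norm (I (\<tau> (r n)))) \<in> limiting_normal_cone C b'))"
proof -
  have b': "b' \<in> C" and u': "u' \<in> admissible_controls U"
    using assms(5) by (auto simp: uniformly_overtaking_optimal_def)
  interpret linear_control_problem f f0 l U C u'
    using assms(1,6,7) u' by (simp add: linear_control_problem_def linear_control_problem_axioms_def)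
  have pmp: "lam' \<ge> 0" "adjoint_solution f f0 (trajectory f b' u') u' \<psi>' lam'" "nontrivial_pair \<psi>' lam'"
    using assms(8) by (auto simp: limiting_pmp_solution_def pmp_solution_def)
  obtain r xs \<psi>s lams where r: "strict_mono (r :: nat \<Rightarrow> nat)"
    and extremal: "\<forall>n. lams n \<ge> (0 :: real) \<and> ode_solution (\<lambda>t y. f y (u' t) t) (xs n) \<and>
        adjoint_solution f f0 (xs n) u' (\<psi>s n) (lams n) \<and> \<psi>s n (\<tau> (r n)) = 0"
    and lim\<psi>: "\<forall>t\<ge>0. (\<lambda>n. \<psi>s n t) \<longlonglongrightarrow> \<psi>' t" and limlam: "lams \<longlonglongrightarrow> lam'"
    using assms(8) unfolding limiting_pmp_solution_def by (elim conjE exE) (rule that)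
  have lams: "lams n \<ge> 0" and xs: "ode_solution (\<lambda>t y. f y (u' t) t) (xs n)"
    and adj: "adjoint_solution f f0 (xs n) u' (\<psi>s n) (lams n)" "\<psi>s n (\<tau> (r n)) = 0" for n
    using extremal by auto
  have \<tau>: "\<tau> n \<ge> 0" for n using assms(4)[of n] by simp
  define I where "I = variation_integral f f0 u' b'"
  have transversality: "\<psi>s n 0 = - (lams n *\<^sub>R I (\<tau> (r n)))" for n
    using adjoint_formula[OF adj(1) \<tau>, of n "r n" b'] adj(2)[of n]
    by (simp add: I_def eq_neg_iff_add_eq_0)
  have lim0: "(\<lambda>n. lams n *\<^sub>R I (\<tau> (r n))) \<longlonglongrightarrow> - \<psi>' 0"
    using tendsto_minus[OF lim\<psi>[rule_format, of 0]] by (simp add: transversality)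
  note minimal = optimal_limit_minimal[OF assms(5) xs \<tau> r, folded I_def]
  have "\<exists>c. c > 0 \<and>
    ((convergent (\<lambda>n. I (\<tau> (r n))) \<and>
      c * lam' = 1 \<and>
      c *\<^sub>R \<psi>' 0 = - lim (\<lambda>n. I (\<tau> (r n))) \<and>
      - lim (\<lambda>n. I (\<tau> (r n))) \<in>
        {p + q |p q. p \<in> limiting_subdifferential l b' \<and> q \<in> limiting_normal_cone C b'})
     \<or>
     (\<not> bounded (range (\<lambda>n. norm (I (\<tau> (r n))))) \<and>
      convergent (\<lambda>n. I (\<tau> (r n)) /\<^sub>R norm (I (\<tau> (r n)))) \<and>
      c * lam' = 0 \<and>
      c *\<^sub>R \<psi>' 0 = - lim (\<lambda>n. I (\<tau> (r n)) /\<^sub>R norm (I (\<tau> (r n)))) \<and>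
      - lim (\<lambda>n. I (\<tau> (r n)) /\<^sub>R norm (I (\<tau> (r n)))) \<in> limiting_normal_cone C b'))"
  proof (cases "lam' = 0")
    case False
    then have "lam' > 0" using pmp(1) by simp
    define v where "v = inverse lam' *\<^sub>R (- \<psi>' 0)"
    have "\<forall>\<^sub>F n in sequentially. inverse (lams n) *\<^sub>R (lams n *\<^sub>R I (\<tau> (r n))) = I (\<tau> (r n))"
      using order_tendstoD(1)[OF limlam \<open>lam' > 0\<close>] by eventually_elim simp
    moreover have "(\<lambda>n. inverse (lams n) *\<^sub>R (lams n *\<^sub>R I (\<tau> (r n)))) \<longlonglongrightarrow> v"
      unfolding v_def by (intro tendsto_intros lim0 limlam False)
    ultimately have v: "(\<lambda>n. I (\<tau> (r n))) \<longlonglongrightarrow> v"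
      by (rule Lim_transform_eventually[rotated])
    obtain \<rho> L where "\<rho> > 0" and L: "L-lipschitz_on (cball b' \<rho>) l"
      using l_lipschitz unfolding locally_lipschitz_def by blast
    have "l b' + inner v b' \<le> l b + inner v b" if "b \<in> C" for b
      using minimal[of "\<lambda>_. 1" 1 v b] v that by (simp add: inner_diff_right)
    then have "- v \<in> {p + q |p q. p \<in> limiting_subdifferential l b' \<and> q \<in> limiting_normal_cone C b'}"
      by (intro minimum_stationary[OF C_closed b' L \<open>\<rho> > 0\<close>])
    moreover have "lim (\<lambda>n. I (\<tau> (r n))) = v" "convergent (\<lambda>n. I (\<tau> (r n)))"
      using v by (auto simp: limI convergent_def)
    ultimately show ?thesis
      using \<open>lam' > 0\<close> by (intro exI[of _ "inverse lam'"]) (simp add: v_def)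
  next
    case True
    have \<psi>0: "\<psi>' 0 \<noteq> 0"
      using pmp(2,3) adjoint_solution_zero True by (auto simp: nontrivial_pair_def)
    define v where "v = (- \<psi>' 0) /\<^sub>R norm (- \<psi>' 0)"
    have nlim: "(\<lambda>n. lams n * norm (I (\<tau> (r n)))) \<longlonglongrightarrow> norm (\<psi>' 0)"
      using tendsto_norm[OF lim0] lams by simp
    \<comment> \<open>Individual multipliers may vanish, but only finitely many, since \<open>\<lambda>\<^sub>n I(\<tau>'\<^sub>n)\<close> has a nonzero limit.\<close>
    have "\<forall>\<^sub>F n in sequentially. lams n * norm (I (\<tau> (r n))) > 0"
      using order_tendstoD(1)[OF nlim] \<psi>0 by simp
    then have pos: "\<forall>\<^sub>F n in sequentially. lams n > 0 \<and> norm (I (\<tau> (r n))) > 0"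
      by eventually_elim (use lams in \<open>auto simp: zero_less_mult_iff not_less order.antisym\<close>)
    have "(\<lambda>n. (lams n *\<^sub>R I (\<tau> (r n))) /\<^sub>R norm (lams n *\<^sub>R I (\<tau> (r n)))) \<longlonglongrightarrow> v"
      unfolding v_def using \<psi>0 by (intro tendsto_intros lim0) auto
    moreover have "\<forall>\<^sub>F n in sequentially. (lams n *\<^sub>R I (\<tau> (r n))) /\<^sub>R norm (lams n *\<^sub>R I (\<tau> (r n)))
        = I (\<tau> (r n)) /\<^sub>R norm (I (\<tau> (r n)))"
      using pos by eventually_elim (simp add: field_simps)
    ultimately have v: "(\<lambda>n. I (\<tau> (r n)) /\<^sub>R norm (I (\<tau> (r n)))) \<longlonglongrightarrow> v"
      by (rule Lim_transform_eventually)
    \<comment> \<open>This writes \<open>1 / norm I\<close> as the quotient of a null sequence and a sequence with positive limit.\<close>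
    have "(\<lambda>n. lams n / (lams n * norm (I (\<tau> (r n))))) \<longlonglongrightarrow> 0 / norm (\<psi>' 0)"
      using limlam nlim \<psi>0 True by (intro tendsto_intros) auto
    moreover have "\<forall>\<^sub>F n in sequentially.
        lams n / (lams n * norm (I (\<tau> (r n)))) = inverse (norm (I (\<tau> (r n))))"
      using pos by eventually_elim (simp add: field_simps)
    ultimately have s: "(\<lambda>n. inverse (norm (I (\<tau> (r n))))) \<longlonglongrightarrow> 0"
      by (simp add: Lim_transform_eventually)
    have unbounded: "\<not> bounded (range (\<lambda>n. norm (I (\<tau> (r n)))))"
    proof
      assume "bounded (range (\<lambda>n. norm (I (\<tau> (r n)))))"
      then obtain K where K: "K > 0" "\<And>n. norm (I (\<tau> (r n))) \<le> K"
        by (auto simp: bounded_pos)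
      have "\<forall>\<^sub>F n in sequentially. inverse (norm (I (\<tau> (r n)))) < inverse K"
        using order_tendstoD(2)[OF s] K(1) by simp
      with pos have "\<forall>\<^sub>F n in sequentially. False"
      proof eventually_elim
        case (elim n)
        then have "K < norm (I (\<tau> (r n)))" using inverse_less_imp_less by blast
        then show ?case using K(2)[of n] by simp
      qed
      then show False by simp
    qed
    have "inner v (b - b') \<ge> 0" if "b \<in> C" for b
      using minimal[OF _ s _ that, of v] v by simp
    then have "- v \<in> proximal_normal_cone C b'"
      unfolding proximal_normal_cone_def by (auto intro!: exI[of _ 0])
    then have "- v \<in> limiting_normal_cone C b'"
      using b' limiting_normal_coneI by blast
    moreover have "lim (\<lambda>n. I (\<tau> (r n)) /\<^sub>R norm (I (\<tau> (r n)))) = v"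
      "convergent (\<lambda>n. I (\<tau> (r n)) /\<^sub>R norm (I (\<tau> (r n))))"
      using v by (auto simp: limI convergent_def)
    ultimately show ?thesis
      using True \<psi>0 unbounded by (intro exI[of _ "inverse (norm (\<psi>' 0))"]) (simp add: v_def)
  qed
  then show ?thesis
    using r unfolding Let_def I_def by blast
qed

end
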